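(* Let $I$ be an interval with smallest element $b$ and largest element $t$, and let $p_I$ be the associated point of the topos $\hat\Delta$ of simplicial sets. Let $G=(\mathbb Z\times I)/\sim$, where $\sim$ identifies $(n,t)\sim(n+1,b)$ for all $n\in\mathbb Z$, endowed with the total order induced by the lexicographic order of $\mathbb Z\times I$ ($n>m\Rightarrow (n,u)>(m,v)$ in $\mathbb Z\times I$, and $(n,u)\ge(n,v)\iff u\ge v$, for $u,v\in I$). Let $c:\mathbb Z\hookrightarrow G$ be the injection $c(n)=(n,b)$. Then a cyclic structure on $p_I$ corresponds to a group law on $G=(\mathbb Z\times I)/\sim$ such that: (i) the order relation on $G$ is left invariant; (ii) the restriction of the group law of $G$ to $c(\mathbb Z)\times G$ is commutative and is given by $c(n)(m,u)=(m,u)c(n)=(n+m,u)$ for all $n,m\in\mathbb Z$, $u\in I$.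
   Context: $\Delta$ is the simplicial category: objects $[n]=\{0,\dots,n\}$, $n\ge0$, morphisms the non-decreasing maps. The cyclic category $\Lambda$ has one object $[n]$ for each $n\ge 0$, and $\mathrm{Hom}_\Lambda([n],[m])$ is the set of non-decreasing maps $f:\mathbb Z\to\mathbb Z$ with $f(x+n+1)=f(x)+m+1$ for all $x$, modulo $f\sim f+k(m+1)$, $k\in\mathbb Z$; composition is composition of maps. The inclusion $j:\Delta\hookrightarrow\Lambda$ is the identity on objects and $j(f)(x+k(n+1))=f(x)+k(m+1)$ for $f\in\mathrm{Hom}_\Delta([n],[m])$, $x\in[n]$, $k\in\mathbb Z$. An interval is a totally ordered set $I$ with a smallest element $b$ and a largest element $t$, $b<t$. The point $p_I$ of $\hat\Delta=\mathrm{Sets}^{\Delta^{\rm op}}$ is given by the flat covariant functor $\mathcal F_I:\Delta\to\mathrm{Sets}$, where $\mathcal F_I([n])$ is the set of non-decreasing sequences $\beta=(\beta_j)_{0\le j\le n+1}$ in $I$ with $\beta_0=b$, $\beta_{n+1}=t$, and for $f\in\mathrm{Hom}_\Delta([n],[m])$, $(f_*\beta)_j=\beta_{f^*(j)}$ with $f^*(j)=\min\{i\in[n]: f(i)\ge j\}$ (and $f^*(j)=n+1$ if there is no such $i$), $0\le j\le m+1$. A cyclic structure on $p_I$ is an extension of $\mathcal F_I$ to a functor $\tilde{\mathcal F}:\Lambda\to\mathrm{Sets}$, i.e. a functor with $\tilde{\mathcal F}\circ j=\mathcal F_I$. *)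

theory Defs
  imports "HOL-Algebra.Group"
begin

text \<open>Categories whose set of objects is \<open>nat\<close> (the object \<open>n\<close> stands for \<open>[n]\<close>), and covariant
  functors from them to sets. \<open>Comp C n m k g f\<close> is the composite of \<open>f : [n] \<rightarrow> [m]\<close> with
  \<open>g : [m] \<rightarrow> [k]\<close>. A functor is given an \<open>undefined\<close> value on everything that is not an arrow
  and, through the extensional function spaces, on everything outside the source of an arrow, so
  that two functors are equal as records iff they are equal as functors.\<close>

record 'a category_on_nat =
  Mor :: "nat \<Rightarrow> nat \<Rightarrow> 'a set"
  Comp :: "nat \<Rightarrow> nat \<Rightarrow> nat \<Rightarrow> 'a \<Rightarrow> 'a \<Rightarrow> 'a"
  Ident :: "nat \<Rightarrow> 'a"

record ('a, 'x) to_sets =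
  Ob :: "nat \<Rightarrow> 'x set"
  Ar :: "nat \<Rightarrow> nat \<Rightarrow> 'a \<Rightarrow> 'x \<Rightarrow> 'x"

definition is_functor :: "'a category_on_nat \<Rightarrow> ('a, 'x) to_sets \<Rightarrow> bool" where
  "is_functor C F \<longleftrightarrow>
     (\<forall>n m. \<forall>f\<in>Mor C n m. Ar F n m f \<in> Ob F n \<rightarrow>\<^sub>E Ob F m) \<and>
     (\<forall>n m f. f \<notin> Mor C n m \<longrightarrow> Ar F n m f = undefined) \<and>
     (\<forall>n. Ar F n n (Ident C n) = restrict id (Ob F n)) \<and>
     (\<forall>n m k. \<forall>f\<in>Mor C n m. \<forall>g\<in>Mor C m k.
        Ar F n k (Comp C n m k g f) = compose (Ob F n) (Ar F m k g) (Ar F n m f))"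

definition Delta :: "(nat \<Rightarrow> nat) category_on_nat" where
  "Delta =
     \<lparr>Mor = (\<lambda>n m. {f \<in> {..n} \<rightarrow>\<^sub>E {..m}. mono_on {..n} f}),
      Comp = (\<lambda>n m k g f. compose {..n} g f),
      Ident = (\<lambda>n. restrict id {..n})\<rparr>"

definition cyclic_maps :: "nat \<Rightarrow> nat \<Rightarrow> (int \<Rightarrow> int) set" where
  "cyclic_maps n m = {f. mono f \<and> (\<forall>x. f (x + int n + 1) = f x + int m + 1)}"

definition shift_rel :: "nat \<Rightarrow> nat \<Rightarrow> ((int \<Rightarrow> int) \<times> (int \<Rightarrow> int)) set" where
  "shift_rel n m = {(f, g). f \<in> cyclic_maps n m \<and> g \<in> cyclic_maps n m \<and>
                            (\<exists>k. \<forall>x. g x = f x + k * (int m + 1))}"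

text \<open>The elementwise composite of two classes is again a full class
  (see \<open>Lambda_Comp_class\<close> below).\<close>

definition Lambda :: "(int \<Rightarrow> int) set category_on_nat" where
  "Lambda =
     \<lparr>Mor = (\<lambda>n m. cyclic_maps n m // shift_rel n m),
      Comp = (\<lambda>n m k \<psi> \<phi>. {g \<circ> f |g f. g \<in> \<psi> \<and> f \<in> \<phi>}),
      Ident = (\<lambda>n. shift_rel n n `` {id})\<rparr>"

definition periodic_ext :: "nat \<Rightarrow> nat \<Rightarrow> (nat \<Rightarrow> nat) \<Rightarrow> int \<Rightarrow> int" where
  "periodic_ext n m f y =
     int (f (nat (y mod (int n + 1)))) + (y div (int n + 1)) * (int m + 1)"

definition incl_j :: "nat \<Rightarrow> nat \<Rightarrow> (nat \<Rightarrow> nat) \<Rightarrow> (int \<Rightarrow> int) set" where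
  "incl_j n m f = shift_rel n m `` {periodic_ext n m f}"

definition comp_j :: "((int \<Rightarrow> int) set, 'x) to_sets \<Rightarrow> (nat \<Rightarrow> nat, 'x) to_sets" where
  "comp_j F =
     \<lparr>Ob = Ob F,
      Ar = (\<lambda>n m f. if f \<in> Mor Delta n m then Ar F n m (incl_j n m f) else undefined)\<rparr>"

text \<open>The underlying set of the interval is a whole (linearly ordered) type.\<close>

definition is_interval :: "'i::linorder \<Rightarrow> 'i \<Rightarrow> bool" where
  "is_interval b t \<longleftrightarrow> (\<forall>x. b \<le> x \<and> x \<le> t) \<and> b < t"

definition seqs :: "'i::linorder \<Rightarrow> 'i \<Rightarrow> nat \<Rightarrow> (nat \<Rightarrow> 'i) set" where
  "seqs b t n = {\<beta> \<in> {..n+1} \<rightarrow>\<^sub>E UNIV. mono_on {..n+1} \<beta> \<and> \<beta> 0 = b \<and> \<beta> (n+1) = t}"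

definition upper_star :: "nat \<Rightarrow> (nat \<Rightarrow> nat) \<Rightarrow> nat \<Rightarrow> nat" where
  "upper_star n f j =
     (if \<exists>i\<in>{..n}. f i \<ge> j then (LEAST i. i \<in> {..n} \<and> f i \<ge> j) else n + 1)"

definition point_functor :: "'i::linorder \<Rightarrow> 'i \<Rightarrow> (nat \<Rightarrow> nat, nat \<Rightarrow> 'i) to_sets" where
  "point_functor b t =
     \<lparr>Ob = seqs b t,
      Ar = (\<lambda>n m f. if f \<in> Mor Delta n m
              then (\<lambda>\<beta>\<in>seqs b t n. \<lambda>j\<in>{..m+1}. \<beta> (upper_star n f j))
              else undefined)\<rparr>"

definition cyclic_structures ::
    "'i::linorder \<Rightarrow> 'i \<Rightarrow> ((int \<Rightarrow> int) set, nat \<Rightarrow> 'i) to_sets set" where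
  "cyclic_structures b t = {F. is_functor Lambda F \<and> comp_j F = point_functor b t}"

definition glue :: "'i \<Rightarrow> 'i \<Rightarrow> ((int \<times> 'i) \<times> (int \<times> 'i)) set" where
  "glue b t = (let r = {((n, t), (n + 1, b)) |n. True} in (r \<union> r\<inverse>)\<^sup>*)"

definition Gset :: "'i \<Rightarrow> 'i \<Rightarrow> (int \<times> 'i) set set" where
  "Gset b t = UNIV // glue b t"

definition cls :: "'i \<Rightarrow> 'i \<Rightarrow> int \<Rightarrow> 'i \<Rightarrow> (int \<times> 'i) set" where
  "cls b t n u = glue b t `` {(n, u)}"

definition lex_le :: "int \<times> 'i::linorder \<Rightarrow> int \<times> 'i \<Rightarrow> bool" where
  "lex_le p q \<longleftrightarrow> fst p < fst q \<or> (fst p = fst q \<and> snd p \<le> snd q)"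

text \<open>The order on classes induced by the lexicographic order; \<open>b\<close> and \<open>t\<close> do not enter because
  classes are sets of representatives.\<close>

definition G_le :: "(int \<times> 'i::linorder) set \<Rightarrow> (int \<times> 'i) set \<Rightarrow> bool" where
  "G_le X Y \<longleftrightarrow> (\<exists>p\<in>X. \<exists>q\<in>Y. lex_le p q)"

definition cc :: "'i \<Rightarrow> 'i \<Rightarrow> int \<Rightarrow> (int \<times> 'i) set" where
  "cc b t n = cls b t n b"

text \<open>The requirement that the product be \<open>undefined\<close> outside of the carrier only serves to make
  equality of records the same as equality of group laws.\<close>

definition group_laws :: "'i::linorder \<Rightarrow> 'i \<Rightarrow> (int \<times> 'i) set monoid set" where
  "group_laws b t = {M. group M \<and> carrier M = Gset b t \<and>
     (\<forall>x y. \<not> (x \<in> Gset b t \<and> y \<in> Gset b t) \<longrightarrow> x \<otimes>\<^bsub>M\<^esub> y = undefined) \<and>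
     (\<forall>g\<in>Gset b t. \<forall>x\<in>Gset b t. \<forall>y\<in>Gset b t. G_le x y \<longrightarrow> G_le (g \<otimes>\<^bsub>M\<^esub> x) (g \<otimes>\<^bsub>M\<^esub> y)) \<and>
     (\<forall>n m u. cc b t n \<otimes>\<^bsub>M\<^esub> cls b t m u = cls b t (n + m) u \<and>
              cls b t m u \<otimes>\<^bsub>M\<^esub> cc b t n = cls b t (n + m) u)}"

text \<open>A sequence \<open>\<beta>\<close> in \<open>\<F>\<^sub>I([n])\<close> is the same thing as a non-decreasing map \<open>\<beta>' : \<int> \<rightarrow> G\<close> with
  \<open>\<beta>' (x + n + 1) = c(1) \<beta>' x\<close>, taken modulo left translations by \<open>G\<close>: every such map has a unique
  left translate with value \<open>c(0)\<close> at \<open>0\<close>, and this translate takes \<open>0, \<dots>, n + 1\<close> to the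
  segment from \<open>c(0) = (0,b)\<close> to \<open>c(1) = (0,t)\<close>, a copy of \<open>I\<close>. In this description \<open>\<Lambda>\<close> acts by
  precomposition with \<open>f\<^sup>t(y) = min {x \<in> \<int>. f x \<ge> y}\<close>, which for \<open>f\<close> coming from \<open>\<Delta>\<close> extends the
  map \<open>f\<^sup>*\<close> in the definition of \<open>\<F>\<^sub>I\<close>. Adding \<open>k(m+1)\<close> to \<open>f\<close> multiplies the result by the
  central element \<open>c(-k)\<close>, which is absorbed by the left translation, so that the choice of the
  representative \<open>f\<close> is immaterial.\<close>

definition unroll :: "'i \<Rightarrow> 'i \<Rightarrow> nat \<Rightarrow> (nat \<Rightarrow> 'i) \<Rightarrow> int \<Rightarrow> (int \<times> 'i) set" where
  "unroll b t n \<beta> x = cls b t (x div (int n + 1)) (\<beta> (nat (x mod (int n + 1))))"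

definition transp :: "(int \<Rightarrow> int) \<Rightarrow> int \<Rightarrow> int" where
  "transp f y = (LEAST x. f x \<ge> y)"

definition cyclic_act :: "'i \<Rightarrow> 'i \<Rightarrow> (int \<times> 'i) set monoid \<Rightarrow>
    nat \<Rightarrow> nat \<Rightarrow> (int \<Rightarrow> int) \<Rightarrow> (nat \<Rightarrow> 'i) \<Rightarrow> nat \<Rightarrow> 'i" where
  "cyclic_act b t M n m f \<beta> =
     (let \<gamma> = unroll b t n \<beta> \<circ> transp f
      in (\<lambda>j\<in>{..m+1}. (THE u. cls b t 0 u = inv\<^bsub>M\<^esub> (\<gamma> 0) \<otimes>\<^bsub>M\<^esub> \<gamma> (int j))))"

definition cyclic_of_group :: "'i::linorder \<Rightarrow> 'i \<Rightarrow> (int \<times> 'i) set monoid \<Rightarrow>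
    ((int \<Rightarrow> int) set, nat \<Rightarrow> 'i) to_sets" where
  "cyclic_of_group b t M =
     \<lparr>Ob = seqs b t,
      Ar = (\<lambda>n m \<phi>. if \<phi> \<in> Mor Lambda n m
              then (\<lambda>\<beta>\<in>seqs b t n. cyclic_act b t M n m (SOME f. f \<in> \<phi>) \<beta>)
              else undefined)\<rparr>"

lemma cyclic_maps_shift:
  assumes "f \<in> cyclic_maps n m"
  shows "f (x + k * (int n + 1)) = f x + k * (int m + 1)"
proof -
  have per: "f (y + (int n + 1)) = f y + (int m + 1)" for y
    using assms by (simp add: cyclic_maps_def add.assoc[symmetric])
  show ?thesis
  proof (induction k rule: int_induct[where k = 0])
    case base
    show ?case by simp
  next
    case (step1 i)
    have "f (x + (i + 1) * (int n + 1)) = f ((x + i * (int n + 1)) + (int n + 1))"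
      by (simp add: algebra_simps)
    then show ?case using per[of "x + i * (int n + 1)"] step1 by (simp add: algebra_simps)
  next
    case (step2 i)
    have "f (x + i * (int n + 1)) = f ((x + (i - 1) * (int n + 1)) + (int n + 1))"
      by (simp add: algebra_simps)
    then show ?case using per[of "x + (i - 1) * (int n + 1)"] step2 by (simp add: algebra_simps)
  qed
qed

lemma cyclic_maps_add:
  assumes "f \<in> cyclic_maps n m"
  shows "(\<lambda>x. f x + k * (int m + 1)) \<in> cyclic_maps n m"
  using assms by (auto simp: cyclic_maps_def mono_def)

lemma cyclic_maps_comp:
  assumes "f \<in> cyclic_maps n m" "g \<in> cyclic_maps m k"
  shows "g \<circ> f \<in> cyclic_maps n k"
proof -
  have "g (f (x + int n + 1)) = g (f x) + int k + 1" for x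
  proof -
    have "f (x + int n + 1) = f x + int m + 1" using assms(1) by (simp add: cyclic_maps_def)
    then show ?thesis using assms(2) by (simp add: cyclic_maps_def)
  qed
  then show ?thesis using assms by (auto simp: cyclic_maps_def mono_def)
qed

lemma shift_rel_iff:
  assumes "f \<in> cyclic_maps n m"
  shows "(f, g) \<in> shift_rel n m \<longleftrightarrow> (\<exists>k. g = (\<lambda>x. f x + k * (int m + 1)))"
proof -
  have "\<exists>k. g = (\<lambda>x. f x + k * (int m + 1))" if "(f, g) \<in> shift_rel n m"
    using that unfolding shift_rel_def fun_eq_iff by blast
  moreover have "(f, \<lambda>x. f x + k * (int m + 1)) \<in> shift_rel n m" for k
    unfolding shift_rel_def using assms cyclic_maps_add[OF assms, of k] by blast
  ultimately show ?thesis by blast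
qed

lemma equiv_shift_rel: "equiv (cyclic_maps n m) (shift_rel n m)"
proof (rule equivI)
  show "shift_rel n m \<subseteq> cyclic_maps n m \<times> cyclic_maps n m" by (auto simp: shift_rel_def)
  show "refl_on (cyclic_maps n m) (shift_rel n m)"
    by (auto simp: refl_on_def shift_rel_def intro: exI[of _ 0])
  show "sym (shift_rel n m)"
  proof (rule symI)
    fix f g assume "(f, g) \<in> shift_rel n m"
    then obtain k where "f \<in> cyclic_maps n m" "g \<in> cyclic_maps n m"
      "\<forall>x. g x = f x + k * (int m + 1)" by (auto simp: shift_rel_def)
    then show "(g, f) \<in> shift_rel n m"
      by (auto simp: shift_rel_def algebra_simps intro!: exI[of _ "- k"])
  qed
  show "trans (shift_rel n m)"
  proof (rule transI)
    fix f g h assume "(f, g) \<in> shift_rel n m" "(g, h) \<in> shift_rel n m"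
    then obtain k l where "f \<in> cyclic_maps n m" "h \<in> cyclic_maps n m"
      "\<forall>x. g x = f x + k * (int m + 1)" "\<forall>x. h x = g x + l * (int m + 1)"
      by (auto simp: shift_rel_def)
    then show "(f, h) \<in> shift_rel n m"
      by (auto simp: shift_rel_def algebra_simps intro!: exI[of _ "k + l"])
  qed
qed

lemma Lambda_Comp_class:
  assumes f: "f \<in> cyclic_maps n m" and g: "g \<in> cyclic_maps m k"
  shows "Comp Lambda n m k (shift_rel m k `` {g}) (shift_rel n m `` {f}) = shift_rel n k `` {g \<circ> f}"
proof -
  note gf = cyclic_maps_comp[OF f g]
  have "h \<in> Comp Lambda n m k (shift_rel m k `` {g}) (shift_rel n m `` {f}) \<longleftrightarrow>
        (\<exists>i. h = (\<lambda>x. (g \<circ> f) x + i * (int k + 1)))" for h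
  proof
    assume "h \<in> Comp Lambda n m k (shift_rel m k `` {g}) (shift_rel n m `` {f})"
    then obtain i l where "h = (\<lambda>x. g x + i * (int k + 1)) \<circ> (\<lambda>x. f x + l * (int m + 1))"
      by (auto simp: Lambda_def shift_rel_iff[OF f] shift_rel_iff[OF g])
    then have "h = (\<lambda>x. (g \<circ> f) x + (l + i) * (int k + 1))"
      by (simp only: fun_eq_iff o_apply cyclic_maps_shift[OF g]) (simp add: algebra_simps)
    then show "\<exists>i. h = (\<lambda>x. (g \<circ> f) x + i * (int k + 1))" ..
  next
    assume "\<exists>i. h = (\<lambda>x. (g \<circ> f) x + i * (int k + 1))"
    then obtain i where h: "h = (\<lambda>x. (g \<circ> f) x + i * (int k + 1))" ..
    have "h = (\<lambda>x. g x + i * (int k + 1)) \<circ> f" by (simp add: h fun_eq_iff)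
    moreover have "(f, f) \<in> shift_rel n m" using f equiv_shift_rel by (meson equiv_class_self Image_singleton_iff)
    ultimately show "h \<in> Comp Lambda n m k (shift_rel m k `` {g}) (shift_rel n m `` {f})"
      by (auto simp: Lambda_def shift_rel_iff[OF g])
  qed
  then show ?thesis using shift_rel_iff[OF gf] by blast
qed

lemma upper_star_le_iff:
  assumes "f \<in> Mor Delta n m" "i \<le> n"
  shows "upper_star n f j \<le> i \<longleftrightarrow> j \<le> f i"
proof (cases "\<exists>i\<in>{..n}. f i \<ge> j")
  case True
  define l where "l = (LEAST i. i \<in> {..n} \<and> f i \<ge> j)"
  have l: "l \<in> {..n} \<and> f l \<ge> j"
    using LeastI_ex[of "\<lambda>i. i \<in> {..n} \<and> f i \<ge> j"] True unfolding l_def by blast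
  have "l \<le> i" if "j \<le> f i"
    using Least_le[of "\<lambda>i. i \<in> {..n} \<and> f i \<ge> j" i] that assms(2) unfolding l_def by blast
  moreover have "j \<le> f i" if "l \<le> i"
  proof -
    have "mono_on {..n} f" using assms(1) by (simp add: Delta_def)
    then have "f l \<le> f i" by (rule mono_onD) (use l assms(2) that in auto)
    then show ?thesis using l by simp
  qed
  moreover have "upper_star n f j = l" using True by (simp only: upper_star_def l_def if_True)
  ultimately show ?thesis by blast
next
  case False
  then have "upper_star n f j = n + 1" by (simp only: upper_star_def if_False)
  then show ?thesis using False assms(2) by auto
qed

lemma upper_star_range: "upper_star n f j \<le> n + 1"
proof (cases "\<exists>i\<in>{..n}. f i \<ge> j")
  case True
  then have "(LEAST i. i \<in> {..n} \<and> f i \<ge> j) \<in> {..n} \<and> f (LEAST i. i \<in> {..n} \<and> f i \<ge> j) \<ge> j"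
    using LeastI_ex[of "\<lambda>i. i \<in> {..n} \<and> f i \<ge> j"] by blast
  then show ?thesis using True by (simp add: upper_star_def)
qed (simp add: upper_star_def)

lemma upper_star_eqI:
  assumes "a \<le> n + 1" "c \<le> n + 1" "\<And>i::nat. i \<le> n \<Longrightarrow> a \<le> i \<longleftrightarrow> c \<le> i"
  shows "a = c"
proof (rule ccontr)
  assume "a \<noteq> c"
  then consider "a < c" | "c < a" by linarith
  then show False by cases (use assms(1,2) assms(3)[of a] assms(3)[of c] in auto)
qed

lemma Delta_le: "f \<in> Mor Delta n m \<Longrightarrow> i \<le> n \<Longrightarrow> f i \<le> m"
  unfolding Delta_def by auto

lemma Delta_Comp:
  assumes "f \<in> Mor Delta n m" "g \<in> Mor Delta m k"
  shows "Comp Delta n m k g f \<in> Mor Delta n k" "i \<le> n \<Longrightarrow> Comp Delta n m k g f i = g (f i)"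
proof -
  have f: "f \<in> {..n} \<rightarrow> {..m}" "mono_on {..n} f" and g: "g \<in> {..m} \<rightarrow> {..k}" "mono_on {..m} g"
    using assms by (simp_all add: Delta_def PiE_def)
  have "compose {..n} g f \<in> {..n} \<rightarrow>\<^sub>E {..k}"
    unfolding PiE_def using f(1) g(1) by (intro IntI funcset_compose compose_extensional)
  moreover have "mono_on {..n} (compose {..n} g f)"
  proof (rule mono_onI)
    fix x y assume xy: "x \<in> {..n}" "y \<in> {..n}" "x \<le> y"
    have "f x \<le> f y" using f(2) xy by (rule mono_onD)
    moreover have "f x \<in> {..m}" "f y \<in> {..m}" using f(1) xy by blast+
    ultimately have "g (f x) \<le> g (f y)" using g(2) by (blast intro: mono_onD)
    then show "compose {..n} g f x \<le> compose {..n} g f y" using xy by (simp add: compose_def)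
  qed
  ultimately show "Comp Delta n m k g f \<in> Mor Delta n k" by (simp add: Delta_def)
  show "i \<le> n \<Longrightarrow> Comp Delta n m k g f i = g (f i)" by (simp add: Delta_def compose_def)
qed

lemma upper_star_Comp:
  assumes "f \<in> Mor Delta n m" "g \<in> Mor Delta m k"
  shows "upper_star n (Comp Delta n m k g f) j = upper_star n f (upper_star m g j)"
proof (rule upper_star_eqI[OF upper_star_range upper_star_range])
  fix i assume i: "i \<le> n"
  show "upper_star n (Comp Delta n m k g f) j \<le> i \<longleftrightarrow> upper_star n f (upper_star m g j) \<le> i"
    by (simp add: upper_star_le_iff[OF Delta_Comp(1)[OF assms] i] Delta_Comp(2)[OF assms i]
      upper_star_le_iff[OF assms(1) i] upper_star_le_iff[OF assms(2) Delta_le[OF assms(1) i]])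
qed

lemma upper_star_mono:
  assumes "f \<in> Mor Delta n m" "j \<le> j'"
  shows "upper_star n f j \<le> upper_star n f j'"
proof (cases "upper_star n f j' \<le> n")
  case True
  then show ?thesis
    using upper_star_le_iff[OF assms(1) True, of j] upper_star_le_iff[OF assms(1) True, of j'] assms(2)
    by simp
next
  case False
  then show ?thesis using upper_star_range[of n f j] by linarith
qed

lemma upper_star_ends:
  assumes "f \<in> Mor Delta n m"
  shows "upper_star n f 0 = 0" "upper_star n f (m + 1) = n + 1"
proof -
  show "upper_star n f 0 = 0" using upper_star_le_iff[OF assms, of 0 0] by simp
  have "\<not> upper_star n f (m + 1) \<le> n"
    using upper_star_le_iff[OF assms, of n "m + 1"] Delta_le[OF assms, of n] by simp
  then show "upper_star n f (m + 1) = n + 1" using upper_star_range[of n f "m + 1"] by linarith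
qed

lemma point_functor_is_functor: "is_functor Delta (point_functor b t)"
proof -
  have ext: "\<beta> = \<beta>'" if "\<beta> \<in> extensional A" "\<beta>' \<in> extensional A" "\<And>j. j \<in> A \<Longrightarrow> \<beta> j = \<beta>' j"
    for \<beta> \<beta>' :: "nat \<Rightarrow> 'a" and A
    using that by (rule extensionalityI)
  have act: "(\<lambda>j\<in>{..m+1}. \<beta> (upper_star n f j)) \<in> seqs b t m"
    if f: "f \<in> Mor Delta n m" and \<beta>: "\<beta> \<in> seqs b t n" for n m f \<beta>
  proof -
    have "mono_on {..n+1} \<beta>" using \<beta> by (simp add: seqs_def)
    then have "mono_on {..m+1} (\<lambda>j\<in>{..m+1}. \<beta> (upper_star n f j))"
      using upper_star_mono[OF f] upper_star_range[of n f] by (auto simp: mono_on_def)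
    then show ?thesis using upper_star_ends[OF f] \<beta> by (simp add: seqs_def)
  qed
  have ident: "Ident Delta n \<in> Mor Delta n n" for n
    by (auto simp: Delta_def mono_on_def)
  have ident_star: "upper_star n (Ident Delta n) j = j" if "j \<le> n + 1" for n j
  proof (rule upper_star_eqI[OF upper_star_range that])
    fix i assume "i \<le> n"
    then show "upper_star n (Ident Delta n) j \<le> i \<longleftrightarrow> j \<le> i"
      by (simp add: upper_star_le_iff[OF ident]) (simp add: Delta_def)
  qed
  have id_case: "Ar (point_functor b t) n n (Ident Delta n) = restrict id (seqs b t n)" for n
  proof -
    have "(\<lambda>j\<in>{..n+1}. \<beta> (upper_star n (Ident Delta n) j)) = \<beta>" if "\<beta> \<in> seqs b t n" for \<beta>
      by (rule ext[where A = "{..n+1}"]) (use that ident_star in \<open>auto simp: seqs_def PiE_def\<close>)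
    then show ?thesis using ident by (auto simp: point_functor_def fun_eq_iff restrict_def)
  qed
  have comp_case: "Ar (point_functor b t) n k (Comp Delta n m k g f) =
      compose (seqs b t n) (Ar (point_functor b t) m k g) (Ar (point_functor b t) n m f)"
    if f: "f \<in> Mor Delta n m" and g: "g \<in> Mor Delta m k" for n m k f g
  proof
    fix \<beta>
    show "Ar (point_functor b t) n k (Comp Delta n m k g f) \<beta> =
      compose (seqs b t n) (Ar (point_functor b t) m k g) (Ar (point_functor b t) n m f) \<beta>"
    proof (cases "\<beta> \<in> seqs b t n")
      case True
      have "upper_star m g j \<le> m + 1" for j by (rule upper_star_range)
      then have "(\<lambda>j\<in>{..k+1}. \<beta> (upper_star n (Comp Delta n m k g f) j)) =
         (\<lambda>j\<in>{..k+1}. (\<lambda>j\<in>{..m+1}. \<beta> (upper_star n f j)) (upper_star m g j))"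
        by (intro restrict_ext) (simp add: upper_star_Comp[OF f g])
      then show ?thesis using True f g Delta_Comp(1)[OF f g] act[OF f True]
        by (simp add: point_functor_def compose_def)
    next
      case False
      then show ?thesis using Delta_Comp(1)[OF f g] by (simp add: point_functor_def compose_def)
    qed
  qed
  have ob: "Ob (point_functor b t) = seqs b t" by (simp add: point_functor_def)
  have maps: "Ar (point_functor b t) n m f \<in> seqs b t n \<rightarrow>\<^sub>E seqs b t m" if "f \<in> Mor Delta n m" for n m f
    using act[OF that] that by (simp add: point_functor_def restrict_PiE_iff)
  have undef: "Ar (point_functor b t) n m f = undefined" if "f \<notin> Mor Delta n m" for n m f
    using that by (simp add: point_functor_def)
  show ?thesis
    unfolding is_functor_def ob by (intro conjI allI ballI impI maps undef id_case comp_case)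
qed

lemma periodic_ext_cyclic:
  assumes "f \<in> Mor Delta n m"
  shows "periodic_ext n m f \<in> cyclic_maps n m"
proof -
  have per: "periodic_ext n m f (x + int n + 1) = periodic_ext n m f x + int m + 1" for x
  proof -
    have "x + int n + 1 = x + (int n + 1)" by simp
    moreover have "(x + (int n + 1)) div (int n + 1) = x div (int n + 1) + 1"
      by (rule div_add_self2) simp
    ultimately show ?thesis
      by (simp only: periodic_ext_def mod_add_self2) (simp add: algebra_simps)
  qed
  have "periodic_ext n m f x \<le> periodic_ext n m f y" if "x \<le> y" for x y
  proof -
    define N where "N = int n + 1"
    have N: "N > 0" by (simp add: N_def)
    have r: "nat (z mod N) \<le> n" "0 \<le> z mod N" for z
      using N pos_mod_bound[OF N, of z] pos_mod_sign[OF N, of z] by (auto simp: N_def)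
    have dle: "x div N \<le> y div N" using that N by (rule zdiv_mono1)
    show ?thesis
    proof (cases "x div N = y div N")
      case True
      have "x mod N \<le> y mod N"
        using that div_mult_mod_eq[of x N] div_mult_mod_eq[of y N] unfolding True by linarith
      then have "f (nat (x mod N)) \<le> f (nat (y mod N))"
        using assms r unfolding Delta_def by (auto simp: mono_on_def)
      then show ?thesis using True by (simp add: periodic_ext_def N_def)
    next
      case False
      then have "x div N + 1 \<le> y div N" using dle by simp
      then have "(x div N + 1) * (int m + 1) \<le> (y div N) * (int m + 1)"
        by (intro mult_right_mono) auto
      moreover have "int (f (nat (x mod N))) \<le> int m" using Delta_le[OF assms r(1)] by simp
      ultimately show ?thesis by (simp add: periodic_ext_def N_def algebra_simps)
    qed
  qed
  then show ?thesis using per by (auto simp: cyclic_maps_def mono_def)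
qed

lemma incl_j_Mor:
  assumes "f \<in> Mor Delta n m"
  shows "incl_j n m f \<in> Mor Lambda n m"
  unfolding incl_j_def Lambda_def category_on_nat.simps
  by (rule quotientI) (rule periodic_ext_cyclic[OF assms])

lemma incl_j_Ident: "incl_j n n (Ident Delta n) = Ident Lambda n"
proof -
  have "nat (y mod (int n + 1)) \<le> n" for y
    using pos_mod_bound[of "int n + 1" y] by linarith
  then have "periodic_ext n n (Ident Delta n) y = y" for y
    by (simp add: periodic_ext_def Delta_def) (simp only: mod_div_mult_eq)
  then have "periodic_ext n n (Ident Delta n) = id" by (simp add: fun_eq_iff)
  then show ?thesis by (simp add: incl_j_def Lambda_def)
qed

lemma incl_j_Comp:
  assumes f: "f \<in> Mor Delta n m" and g: "g \<in> Mor Delta m k"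
  shows "incl_j n k (Comp Delta n m k g f) = Comp Lambda n m k (incl_j m k g) (incl_j n m f)"
proof -
  have "periodic_ext n k (Comp Delta n m k g f) y = (periodic_ext m k g \<circ> periodic_ext n m f) y" for y
  proof -
    define i where "i = nat (y mod (int n + 1))"
    have i: "i \<le> n" using pos_mod_bound[of "int n + 1" y] by (simp add: i_def)
    have "int (f i) < int m + 1" using Delta_le[OF f i] by simp
    then have "periodic_ext m k g (int (f i)) = int (g (f i))"
      by (simp add: periodic_ext_def)
    then show ?thesis
      using cyclic_maps_shift[OF periodic_ext_cyclic[OF g], of "int (f i)" "y div (int n + 1)"]
        Delta_Comp(2)[OF f g i]
      by (simp add: periodic_ext_def[of n] i_def[symmetric])
  qed
  then have "periodic_ext n k (Comp Delta n m k g f) = periodic_ext m k g \<circ> periodic_ext n m f"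
    by (rule HOL.ext)
  then show ?thesis
    unfolding incl_j_def using Lambda_Comp_class[OF periodic_ext_cyclic[OF f] periodic_ext_cyclic[OF g]]
    by simp
qed

lemma glue_iff:
  assumes "b \<noteq> t"
  shows "((n, u), (m, v)) \<in> glue b t \<longleftrightarrow>
     (n = m \<and> u = v) \<or> (u = t \<and> v = b \<and> m = n + 1) \<or> (u = b \<and> v = t \<and> n = m + 1)"
proof -
  define r where "r = {((n::int, t), (n + 1, b)) |n. True}"
  define s where "s = {((n::int, u), (m, v)). (n = m \<and> u = v) \<or> (u = t \<and> v = b \<and> m = n + 1)
                         \<or> (u = b \<and> v = t \<and> n = m + 1)}"
  have "(r \<union> r\<inverse>)\<^sup>* = s"
  proof
    show "(r \<union> r\<inverse>)\<^sup>* \<subseteq> s"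
    proof (rule subrelI)
      fix p q assume "(p, q) \<in> (r \<union> r\<inverse>)\<^sup>*"
      then show "(p, q) \<in> s"
        by induction (use assms in \<open>auto simp: r_def s_def\<close>)
    qed
    show "s \<subseteq> (r \<union> r\<inverse>)\<^sup>*"
      by (auto simp: r_def s_def)
  qed
  then have "glue b t = s" unfolding glue_def Let_def r_def .
  then show ?thesis by (simp add: s_def)
qed

lemma equiv_glue: "equiv UNIV (glue b t)"
  unfolding glue_def Let_def
  by (intro equivI refl_rtrancl trans_rtrancl sym_rtrancl sym_Un_converse) auto

lemma cls_in_Gset: "cls b t n u \<in> Gset b t"
  by (simp add: cls_def Gset_def quotientI)

lemma Gset_cases:
  assumes "X \<in> Gset b t" obtains n u where "X = cls b t n u"
  using assms by (auto simp: cls_def Gset_def elim!: quotientE)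

lemma G_le_total_order:
  assumes "is_interval b t"
  shows "X \<in> Gset b t \<Longrightarrow> Y \<in> Gset b t \<Longrightarrow> G_le X Y \<or> G_le Y X"
    and "X \<in> Gset b t \<Longrightarrow> Y \<in> Gset b t \<Longrightarrow> G_le X Y \<Longrightarrow> G_le Y X \<Longrightarrow> X = Y"
    and "X \<in> Gset b t \<Longrightarrow> Y \<in> Gset b t \<Longrightarrow> Z \<in> Gset b t \<Longrightarrow> G_le X Y \<Longrightarrow> G_le Y Z \<Longrightarrow> G_le X Z"
proof -
  have bt: "b \<noteq> t" "\<And>x. b \<le> x" "\<And>x. x \<le> t" using assms by (auto simp: is_interval_def)
  have self: "p \<in> X \<Longrightarrow> X \<in> Gset b t \<Longrightarrow> X = glue b t `` {p}" for p X
    by (metis Gset_def Image_singleton_iff equiv_class_eq equiv_glue quotientE)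
  have convex: "(p, q) \<in> glue b t"
    if "lex_le p q" "lex_le q p'" "(p, p') \<in> glue b t" for p q p'
    using that bt by (cases p; cases q; cases p')
      (auto simp: glue_iff[OF bt(1)] lex_le_def dest: antisym)
  have lex_trans: "lex_le p q \<Longrightarrow> lex_le q s \<Longrightarrow> lex_le p s" for p q s :: "int \<times> 'a"
    by (auto simp: lex_le_def)
  have lex_total: "lex_le p q \<or> lex_le q p" for p q :: "int \<times> 'a"
    by (auto simp: lex_le_def)
  have rel: "p \<in> X \<Longrightarrow> q \<in> X \<Longrightarrow> X \<in> Gset b t \<Longrightarrow> (p, q) \<in> glue b t" for p q X
    using self by blast
  have nonempty: "X \<in> Gset b t \<Longrightarrow> \<exists>p. p \<in> X" for X
    using self equiv_glue by (metis Gset_cases cls_def equiv_class_self UNIV_I)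
  have eq: "p \<in> X \<Longrightarrow> q \<in> Y \<Longrightarrow> (p, q) \<in> glue b t \<Longrightarrow> X \<in> Gset b t \<Longrightarrow> Y \<in> Gset b t \<Longrightarrow> X = Y"
    for p q X Y
    using self equiv_class_eq[OF equiv_glue] by metis
  have all: "lex_le p q" if asm: "G_le X Y" "X \<noteq> Y" "p \<in> X" "q \<in> Y" "X \<in> Gset b t" "Y \<in> Gset b t"
    for X Y p q
  proof (rule ccontr)
    assume "\<not> lex_le p q"
    then have qp: "lex_le q p" using lex_total by blast
    obtain p' q' where pq: "p' \<in> X" "q' \<in> Y" "lex_le p' q'" using asm(1) unfolding G_le_def by blast
    show False
    proof (cases "lex_le p q'")
      case True
      then have "(q, p) \<in> glue b t" using convex[OF qp True] rel[OF asm(4) pq(2) asm(6)] by blast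
      then show False using eq[OF asm(3,4) _ asm(5,6)] asm(2) equiv_glue by (meson equivE symE)
    next
      case False
      then have "lex_le q' p" using lex_total by blast
      then have "(p', q') \<in> glue b t" using convex[OF pq(3)] rel[OF pq(1) asm(3) asm(5)] by blast
      then show False using eq[OF pq(1,2) _ asm(5,6)] asm(2) by blast
    qed
  qed
  show "G_le X Y \<or> G_le Y X" if "X \<in> Gset b t" "Y \<in> Gset b t"
    using nonempty[OF that(1)] nonempty[OF that(2)] lex_total unfolding G_le_def by blast
  show "X = Y" if asm: "X \<in> Gset b t" "Y \<in> Gset b t" "G_le X Y" "G_le Y X"
  proof (rule ccontr)
    assume ne: "X \<noteq> Y"
    obtain p q where pq: "p \<in> X" "q \<in> Y" using nonempty[OF asm(1)] nonempty[OF asm(2)] by blast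
    have "lex_le p q" "lex_le q p" using all[OF asm(3) ne pq asm(1,2)] all[OF asm(4) ne[symmetric] pq(2,1) asm(2,1)] by blast+
    then have "p = q" by (cases p; cases q) (auto simp: lex_le_def)
    then show False using pq self[OF _ asm(1)] self[OF _ asm(2)] ne by metis
  qed
  show "G_le X Z" if asm: "X \<in> Gset b t" "Y \<in> Gset b t" "Z \<in> Gset b t" "G_le X Y" "G_le Y Z"
  proof (cases "X = Y \<or> Y = Z")
    case True then show ?thesis using asm by blast
  next
    case False
    obtain p q s where pqs: "p \<in> X" "q \<in> Y" "s \<in> Z" using nonempty[OF asm(1)] nonempty[OF asm(2)] nonempty[OF asm(3)] by blast
    have "lex_le p s"
      using all[OF asm(4) _ pqs(1,2) asm(1,2)] all[OF asm(5) _ pqs(2,3) asm(2,3)] False lex_trans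
      by blast
    then show ?thesis using pqs unfolding G_le_def by blast
  qed
qed

end

theory Submission
  imports Defs
begin

text \<open>Given a group law, a cyclic map \<open>f\<close> acts on a sequence by extending it periodically to
  \<open>\<int>\<close>, precomposing with \<open>f\<^sup>t\<close> and translating the result back to \<open>c(0)\<close>. Applied to
  translations of \<open>\<int>\<close> this shows that the functor knows all quotients \<open>x\<inverse> y\<close>, hence the group
  law.

  Conversely, given a cyclic structure, the quotient of \<open>x, y \<in> G\<close> is read off by choosing a
  sequence whose periodic extension takes the values \<open>x\<close> and \<open>y\<close> and rotating it so that the
  place of \<open>x\<close> becomes the base point. Any two such sequences are restrictions, along maps of
  \<open>\<Delta>\<close>, of a common strictly increasing one, in which the places of \<open>x\<close> and \<open>y\<close> are determined;
  so the quotient \<open>d\<close> is well defined. Composing rotations gives \<open>d (d x y) (d x z) = d y z\<close>, which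
  together with \<open>d x x = 1\<close> and \<open>d 1 x = x\<close> makes \<open>d\<close> the left division of a group.\<close>

section \<open>Transposes of cyclic maps\<close>

text \<open>At \<open>x = a\<close> the hypothesis gives that \<open>a\<close> itself qualifies,
  elsewhere that nothing smaller does. Identities between transposes thus reduce to equivalences of
  inequalities.\<close>

lemma transp_eqI:
  assumes "\<And>x. a \<le> x \<longleftrightarrow> y \<le> f x"
  shows "transp f y = a"
  unfolding transp_def by (rule Least_equality) (use assms in auto)

text \<open>This says that \<open>f\<^sup>t\<close> is left adjoint to \<open>f\<close>. The minimum
  exists because periodicity makes \<open>f\<close> unbounded in both directions; on the integers
  \<open>LEAST\<close> guarantees nothing by itself.\<close>

lemma transp_le_iff:
  assumes "f \<in> cyclic_maps n m"
  shows "transp f y \<le> x \<longleftrightarrow> y \<le> f x"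
proof -
  have mono: "f x \<le> f x'" if "x \<le> x'" for x x'
    using assms that by (auto simp: cyclic_maps_def mono_def)
  \<comment> \<open>Moving by \<open>k\<close> periods changes the value by at least
    \<open>k\<close>, which exceeds the distance from \<open>f 0\<close> to \<open>y\<close>. So
    \<open>k\<close> periods back lie below \<open>y\<close>, and \<open>k\<close> periods ahead
    reach it.\<close>
  define k where "k = \<bar>f 0\<bar> + \<bar>y\<bar> + 1"
  have k: "k > \<bar>f 0\<bar> + \<bar>y\<bar>" "k \<ge> 0"
    by (auto simp: k_def)
  have "k * 1 \<le> k * (int m + 1)"
    by (rule mult_left_mono) (use k in auto)
  moreover have "f (- k * (int n + 1)) = f 0 - k * (int m + 1)"
    using cyclic_maps_shift[OF assms, of 0 "- k"] by simp
  moreover have "f (k * (int n + 1)) = f 0 + k * (int m + 1)"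
    using cyclic_maps_shift[OF assms, of 0 k] by simp
  ultimately have low: "\<not> y \<le> f (- k * (int n + 1))" and high: "y \<le> f (k * (int n + 1))"
    using k by linarith+
  \<comment> \<open>Counting upward from a point where \<open>f\<close> is still below
    \<open>y\<close> turns the search into one over the naturals, which are well-ordered.\<close>
  define P where "P i \<longleftrightarrow> y \<le> f (- k * (int n + 1) + int i)" for i
  have "P (nat (2 * k * (int n + 1)))"
    using high k(2) by (simp add: P_def algebra_simps)
  then have Least: "P (LEAST i. P i)" "\<And>i. P i \<Longrightarrow> (LEAST i. P i) \<le> i"
    by (auto intro: LeastI Least_le)
  define a where "a = - k * (int n + 1) + int (LEAST i. P i)"
  have *: "a \<le> x \<longleftrightarrow> y \<le> f x" for x
  proof
    assume "a \<le> x"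
    then show "y \<le> f x" using Least(1) mono[of a x] by (simp add: P_def a_def)
  next
    assume y: "y \<le> f x"
    have "- k * (int n + 1) \<le> x"
      using y low mono[of x "- k * (int n + 1)"] by linarith
    then have "P (nat (x + k * (int n + 1)))"
      using y by (simp add: P_def)
    then show "a \<le> x"
      using Least(2)[of "nat (x + k * (int n + 1))"] \<open>- k * (int n + 1) \<le> x\<close>
      by (simp add: a_def algebra_simps)
  qed
  show ?thesis using transp_eqI[OF *] * by simp
qed

text \<open>On representatives, this and \<open>transp_comp\<close> give the duality of \<Lambda>
  with its opposite, which lets a covariant action be written as precomposition.\<close>

lemma transp_cyclic_maps:
  assumes "f \<in> cyclic_maps n m"
  shows "transp f \<in> cyclic_maps m n"
proof -
  note iff = transp_le_iff[OF assms]
  have "transp f y \<le> transp f y'" if "y \<le> y'" for y y'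
    using that iff[of y "transp f y'"] iff[of y' "transp f y'"] by simp
  moreover have "transp f (y + int m + 1) = transp f y + int n + 1" for y
  proof (rule transp_eqI)
    fix x
    have "f x = f (x - (int n + 1)) + int m + 1"
      using cyclic_maps_shift[OF assms, of "x - (int n + 1)" 1] by simp
    then show "transp f y + int n + 1 \<le> x \<longleftrightarrow> y + int m + 1 \<le> f x"
      using iff[of y "x - (int n + 1)"] by linarith
  qed
  ultimately show ?thesis by (auto simp: cyclic_maps_def mono_def)
qed

lemma transp_comp:
  assumes "f \<in> cyclic_maps n m" "g \<in> cyclic_maps m k"
  shows "transp (g \<circ> f) = transp f \<circ> transp g"
proof
  fix y
  show "transp (g \<circ> f) y = (transp f \<circ> transp g) y"
    by (rule transp_eqI) (simp add: transp_le_iff[OF assms(1)] transp_le_iff[OF assms(2)])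
qed

text \<open>Both equations move \<open>k\<close> across the adjunction. The first serves to change
  the representative of an arrow and the base point of its target, the second to bring
  \<open>f\<^sup>t(0)\<close> to \<open>0\<close>.\<close>

lemma transp_add:
  assumes "f \<in> cyclic_maps n m"
  shows "transp (\<lambda>x. f x + k) y = transp f (y - k)"
    and "transp (\<lambda>x. f (x + k)) y = transp f y - k"
  by (rule transp_eqI; use transp_le_iff[OF assms, of "y - k"] in force)
     (rule transp_eqI, simp flip: transp_le_iff[OF assms], linarith)

lemma translation_cyclic_maps: "(\<lambda>x. x + k) \<in> cyclic_maps n n"
  by (auto simp: cyclic_maps_def mono_def)

lemma transp_translation: "transp (\<lambda>x. x + k) y = y - k"
  by (rule transp_eqI) linarith

lemma transp_id [simp]: "transp id = id"
  by (rule ext, rule transp_eqI) simp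

text \<open>The extension is negative to the left of \<open>0\<close> and at least
  \<open>m + 1\<close> to the right of \<open>n\<close>, so the minimum over all integers lies in
  \<open>0, ..., n + 1\<close>. In particular the default value \<open>n + 1\<close> of
  \<open>upper_star\<close> is a genuine minimum.\<close>

lemma transp_periodic_ext:
  assumes "f \<in> Mor Delta n m" "j \<le> m + 1"
  shows "transp (periodic_ext n m f) (int j) = int (upper_star n f j)"
proof -
  note cyc = periodic_ext_cyclic[OF assms(1)]
  have val: "periodic_ext n m f (int i) = int (f i)" if "i \<le> n" for i
    using that by (simp add: periodic_ext_def)
  have "periodic_ext n m f (-1) = int (f n) - (int m + 1)"
    using cyclic_maps_shift[OF cyc, of "int n" "-1"] val[of n] by simp
  then have neg: "periodic_ext n m f x < 0" if "x < 0" for x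
    using that cyc Delta_le[OF assms(1), of n]
      monoD[of "periodic_ext n m f" x "-1"] by (simp add: cyclic_maps_def)
  have top: "periodic_ext n m f x \<ge> int m + 1" if "x > int n" for x
    using that cyc monoD[of "periodic_ext n m f" "int n + 1" x]
      cyclic_maps_shift[OF cyc, of 0 1] val[of 0] by (simp add: cyclic_maps_def)
  show ?thesis
  proof (rule transp_eqI)
    fix x
    consider "x < 0" | i where "x = int i" "i \<le> n" | "x > int n"
      by (metis not_less zero_le_imp_eq_int zle_int)
    then show "int (upper_star n f j) \<le> x \<longleftrightarrow> int j \<le> periodic_ext n m f x"
    proof cases
      case 1
      then show ?thesis using neg[OF 1] by linarith
    next
      case 2
      then show ?thesis using upper_star_le_iff[OF assms(1), of i j] val by simp
    next
      case 3
      then show ?thesis using top[OF 3] upper_star_range[of n f j] assms(2) by linarith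
    qed
  qed
qed

text \<open>The image of \<open>j\<close> is cut out by \<open>f\<^sup>t(0) = 0\<close>.\<close>

lemma cyclic_maps_from_Delta:
  assumes "f \<in> cyclic_maps n m" "transp f 0 = 0"
  obtains f\<^sub>0 where "f\<^sub>0 \<in> Mor Delta n m" "f = periodic_ext n m f\<^sub>0"
proof
  have mono: "f x \<le> f x'" if "x \<le> x'" for x x'
    using assms that by (auto simp: cyclic_maps_def mono_def)
  have iff: "0 \<le> x \<longleftrightarrow> 0 \<le> f x" for x
    using transp_le_iff[OF assms(1), of 0 x] assms(2) by simp
  \<comment> \<open>The value at \<open>-1\<close> is negative by \<open>iff\<close>; one period
    later this bounds the value at \<open>n\<close>.\<close>
  have "f (int n) < int m + 1"
    using cyclic_maps_shift[OF assms(1), of "int n" "-1"] iff[of "-1"] by simp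
  then have le: "f x \<le> int m" if "x \<le> int n" for x
    using mono[OF that] by simp
  show "(\<lambda>i\<in>{..n}. nat (f (int i))) \<in> Mor Delta n m"
    using le nat_mono[OF mono] by (auto simp: Delta_def mono_on_def nat_le_iff)
  show "f = periodic_ext n m (\<lambda>i\<in>{..n}. nat (f (int i)))"
  proof
    fix x
    define r where "r = x mod (int n + 1)"
    have r: "0 \<le> r" "r \<le> int n"
      using pos_mod_bound[of "int n + 1" x] by (auto simp: r_def)
    have "f x = f (r + x div (int n + 1) * (int n + 1))"
      by (simp only: r_def mod_div_mult_eq)
    also have "\<dots> = f r + x div (int n + 1) * (int m + 1)"
      by (rule cyclic_maps_shift[OF assms(1)])
    finally show "f x = periodic_ext n m (\<lambda>i\<in>{..n}. nat (f (int i))) x"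
      using r iff[of r] by (simp add: periodic_ext_def nat_le_iff flip: r_def)
  qed
qed

section \<open>Arrows of \<Lambda> as classes of cyclic maps\<close>

abbreviation Lambda_class :: "nat \<Rightarrow> nat \<Rightarrow> (int \<Rightarrow> int) \<Rightarrow> (int \<Rightarrow> int) set" where
  "Lambda_class n m f \<equiv> shift_rel n m `` {f}"

lemma Lambda_class_Mor: "f \<in> cyclic_maps n m \<Longrightarrow> Lambda_class n m f \<in> Mor Lambda n m"
  by (simp add: Lambda_def quotientI)

lemma Lambda_Mor_cases:
  assumes "\<phi> \<in> Mor Lambda n m"
  obtains f where "f \<in> cyclic_maps n m" "\<phi> = Lambda_class n m f"
  using assms by (auto simp: Lambda_def elim: quotientE)

lemma Lambda_class_some:
  assumes "f \<in> cyclic_maps n m"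
  obtains k where "(SOME g. g \<in> Lambda_class n m f) = (\<lambda>x. f x + k * (int m + 1))"
proof -
  have "f \<in> Lambda_class n m f"
    by (simp add: shift_rel_iff[OF assms] exI[of _ 0])
  then have "(SOME g. g \<in> Lambda_class n m f) \<in> Lambda_class n m f"
    by (rule someI[of "\<lambda>g. g \<in> Lambda_class n m f"])
  then show ?thesis using that shift_rel_iff[OF assms] by auto
qed

section \<open>Periodic monotone sequences in \<open>G\<close>\<close>

text \<open>By condition (ii) this is multiplication by \<open>c(k)\<close> in every admissible
  group law, but it is available before any law is chosen.\<close>

definition shift :: "int \<Rightarrow> (int \<times> 'i) set \<Rightarrow> (int \<times> 'i) set" where
  "shift k X = (\<lambda>(n, u). (n + k, u)) ` X"

locale interval =
  fixes b t :: "'i::linorder"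
  assumes interval: "is_interval b t"
begin

lemma b_neq_t: "b \<noteq> t" and b_least: "b \<le> x" and t_greatest: "x \<le> t"
  using interval by (auto simp: is_interval_def)

lemma cls_eq_iff:
  "cls b t n u = cls b t m v \<longleftrightarrow>
     (n = m \<and> u = v) \<or> (u = t \<and> v = b \<and> m = n + 1) \<or> (u = b \<and> v = t \<and> n = m + 1)"
  unfolding cls_def by (simp add: eq_equiv_class_iff[OF equiv_glue] glue_iff[OF b_neq_t])

lemma mem_cls_iff:
  "(m, v) \<in> cls b t n u \<longleftrightarrow>
     (n = m \<and> u = v) \<or> (u = t \<and> v = b \<and> m = n + 1) \<or> (u = b \<and> v = t \<and> n = m + 1)"
  unfolding cls_def by (simp add: glue_iff[OF b_neq_t])

text \<open>The last alternative is the glued point \<open>(m + 1, b) = (m, t)\<close>, where the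
  order of the displayed representatives is the wrong way round.\<close>

lemma G_le_cls_iff:
  "G_le (cls b t n u) (cls b t m v) \<longleftrightarrow>
     n < m \<or> (n = m \<and> u \<le> v) \<or> (n = m + 1 \<and> u = b \<and> v = t)"
proof
  assume "G_le (cls b t n u) (cls b t m v)"
  then show "n < m \<or> (n = m \<and> u \<le> v) \<or> (n = m + 1 \<and> u = b \<and> v = t)"
    unfolding G_le_def
    using b_neq_t
    by (auto simp: mem_cls_iff lex_le_def b_least t_greatest
        dest: antisym[OF _ b_least] antisym[OF t_greatest])
next
  assume R: "n < m \<or> (n = m \<and> u \<le> v) \<or> (n = m + 1 \<and> u = b \<and> v = t)"
  have "(n, u) \<in> cls b t n u" "(m, v) \<in> cls b t m v" "v = t \<Longrightarrow> (m + 1, b) \<in> cls b t m v"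
    by (simp_all add: mem_cls_iff)
  then show "G_le (cls b t n u) (cls b t m v)"
    unfolding G_le_def Bex_def using R by (elim disjE) (fastforce simp: lex_le_def)+
qed

lemma shift_cls [simp]: "shift k (cls b t n u) = cls b t (n + k) u"
proof (rule Set.set_eqI)
  fix p :: "int \<times> 'i"
  obtain m v where p: "p = (m, v)" by fastforce
  have "p \<in> shift k (cls b t n u) \<longleftrightarrow> (m - k, v) \<in> cls b t n u"
    unfolding shift_def p by (auto simp: image_iff intro: bexI[of _ "(m - k, v)"])
  moreover have "n = m - k \<longleftrightarrow> n + k = m" "m - k = n + 1 \<longleftrightarrow> m = n + k + 1"
    "n = m - k + 1 \<longleftrightarrow> n + k = m + 1"
    by linarith+
  ultimately show "p \<in> shift k (cls b t n u) \<longleftrightarrow> p \<in> cls b t (n + k) u"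
    unfolding p mem_cls_iff by simp
qed

lemma shift_Gset: "X \<in> Gset b t \<Longrightarrow> shift k X \<in> Gset b t"
  by (auto elim!: Gset_cases simp: cls_in_Gset)

lemma shift_shift: "X \<in> Gset b t \<Longrightarrow> shift k (shift l X) = shift (l + k) X"
  by (auto elim!: Gset_cases simp: add.assoc)

lemma shift_0: "X \<in> Gset b t \<Longrightarrow> shift 0 X = X"
  by (auto elim!: Gset_cases)

lemma segment:
  assumes "X \<in> Gset b t" "G_le (cc b t 0) X" "G_le X (cc b t 1)"
  obtains u where "X = cls b t 0 u"
proof -
  obtain n u where X: "X = cls b t n u"
    using Gset_cases[OF assms(1)] .
  \<comment> \<open>The end points have a second representative each: \<open>c(1)\<close> is both
    \<open>(1, b)\<close> and \<open>(0, t)\<close>, and \<open>c(0)\<close> is both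
    \<open>(-1, t)\<close> and \<open>(0, b)\<close>.\<close>
  have "n = 0 \<or> (n = 1 \<and> u = b) \<or> (n = -1 \<and> u = t)"
    using assms(2,3) b_neq_t b_least[of u] unfolding X cc_def G_le_cls_iff by auto
  then have "X = cls b t 0 u \<or> X = cls b t 0 t \<or> X = cls b t 0 b"
    unfolding X cls_eq_iff by auto
  then show ?thesis using that by blast
qed

lemma the_cls: "(THE u. cls b t 0 u = cls b t 0 v) = v"
  by (auto simp: cls_eq_iff)

text \<open>No value at \<open>0\<close> is prescribed, so that precomposition with arbitrary cyclic
  maps stays inside.\<close>

definition lines :: "nat \<Rightarrow> (int \<Rightarrow> (int \<times> 'i) set) set" where
  "lines n = {\<gamma>. (\<forall>x. \<gamma> x \<in> Gset b t) \<and> (\<forall>x y. x \<le> y \<longrightarrow> G_le (\<gamma> x) (\<gamma> y)) \<and>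
     (\<forall>x k. \<gamma> (x + k * (int n + 1)) = shift k (\<gamma> x))}"

lemma linesD:
  assumes "\<gamma> \<in> lines n"
  shows "\<gamma> x \<in> Gset b t" "x \<le> y \<Longrightarrow> G_le (\<gamma> x) (\<gamma> y)"
    "\<gamma> (x + k * (int n + 1)) = shift k (\<gamma> x)"
  using assms by (auto simp: lines_def)

lemma lines_comp:
  assumes "\<gamma> \<in> lines n" "h \<in> cyclic_maps m n"
  shows "\<gamma> \<circ> h \<in> lines m"
  using linesD[OF assms(1)] assms(2)
  by (auto simp: lines_def cyclic_maps_shift[OF assms(2)] cyclic_maps_def mono_def)

lemma unroll_of_nat:
  assumes "\<beta> \<in> seqs b t n" "j \<le> n + 1"
  shows "unroll b t n \<beta> (int j) = cls b t 0 (\<beta> j)"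
\<comment> \<open>At \<open>n + 1\<close> the next period has begun: \<open>unroll\<close> yields
  \<open>(1, b)\<close>, which is glued to \<open>(0, t)\<close>.\<close>
proof (cases "j = n + 1")
  case True
  then show ?thesis using assms(1) by (simp add: unroll_def seqs_def cls_eq_iff add.commute)
next
  case False
  then show ?thesis using assms(2) by (simp add: unroll_def)
qed

lemma unroll_eq:
  obtains i where "i \<le> n" "unroll b t n \<beta> x = cls b t (x div (int n + 1)) (\<beta> i)"
    "x = int i + x div (int n + 1) * (int n + 1)"
proof
  show "nat (x mod (int n + 1)) \<le> n"
    using pos_mod_bound[of "int n + 1" x] by linarith
qed (simp_all add: unroll_def mod_div_mult_eq)

lemma unroll_lines:
  assumes "\<beta> \<in> seqs b t n"
  shows "unroll b t n \<beta> \<in> lines n"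
proof -
  have "G_le (unroll b t n \<beta> x) (unroll b t n \<beta> y)" if "x \<le> y" for x y
  proof (cases "x div (int n + 1) = y div (int n + 1)")
    case True
    obtain i where i: "i \<le> n" "unroll b t n \<beta> x = cls b t (x div (int n + 1)) (\<beta> i)"
      "x = int i + x div (int n + 1) * (int n + 1)" by (rule unroll_eq)
    obtain j where j: "j \<le> n" "unroll b t n \<beta> y = cls b t (y div (int n + 1)) (\<beta> j)"
      "y = int j + y div (int n + 1) * (int n + 1)" by (rule unroll_eq)
    have "i \<le> j" using that i(3) j(3) unfolding True by linarith
    then have "\<beta> i \<le> \<beta> j" using assms j(1) by (auto simp: seqs_def mono_on_def)
    then show ?thesis unfolding i(2) j(2) G_le_cls_iff using True by simp
  next
    case False
    then show ?thesis
      using that zdiv_mono1[of x y "int n + 1"] by (simp add: unroll_def G_le_cls_iff)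
  qed
  moreover have "unroll b t n \<beta> (x + k * (int n + 1)) = shift k (unroll b t n \<beta> x)" for x k
    by (simp add: unroll_def add.commute)
  ultimately show ?thesis
    by (auto simp: lines_def unroll_def cls_in_Gset)
qed

lemma unroll_0: "\<beta> \<in> seqs b t n \<Longrightarrow> unroll b t n \<beta> 0 = cc b t 0"
  using unroll_of_nat[of \<beta> n 0] by (simp add: seqs_def cc_def)

text \<open>Inverse to \<open>unroll\<close> on lines with value \<open>c(0)\<close> at
  \<open>0\<close>; only for those is the description sure to denote.\<close>

definition roll :: "nat \<Rightarrow> (int \<Rightarrow> (int \<times> 'i) set) \<Rightarrow> nat \<Rightarrow> 'i" where
  "roll n \<gamma> = (\<lambda>j\<in>{..n+1}. THE u. cls b t 0 u = \<gamma> (int j))"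

lemma roll_unroll:
  assumes "\<beta> \<in> seqs b t n"
  shows "roll n (unroll b t n \<beta>) = \<beta>"
proof (rule extensionalityI[of _ "{..n+1}"])
  fix j assume "j \<in> {..n+1}"
  then show "roll n (unroll b t n \<beta>) j = \<beta> j"
    using unroll_of_nat[OF assms, of j] the_cls by (simp add: roll_def)
qed (use assms in \<open>simp_all add: roll_def seqs_def PiE_def\<close>)

lemma unroll_inject:
  assumes "\<beta> \<in> seqs b t n" "\<beta>' \<in> seqs b t n" "unroll b t n \<beta> = unroll b t n \<beta>'"
  shows "\<beta> = \<beta>'"
  using roll_unroll assms by metis

text \<open>By periodicity the value at \<open>n + 1\<close> is \<open>c(1)\<close>, so by
  monotonicity all values in between lie in the segment from \<open>c(0)\<close> to
  \<open>c(1)\<close>, the copy of the interval.\<close>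

lemma roll_lines:
  assumes "\<gamma> \<in> lines n" "\<gamma> 0 = cc b t 0"
  shows "roll n \<gamma> \<in> seqs b t n" and "unroll b t n (roll n \<gamma>) = \<gamma>"
proof -
  have top: "\<gamma> (int n + 1) = cc b t 1"
    using linesD(3)[OF assms(1), of 0 1] assms(2) by (simp add: cc_def)
  have roll: "cls b t 0 (roll n \<gamma> j) = \<gamma> (int j)" if "j \<le> n + 1" for j
  proof -
    have "G_le (cc b t 0) (\<gamma> (int j))" "G_le (\<gamma> (int j)) (cc b t 1)"
      using linesD(2)[OF assms(1), of 0 "int j"] linesD(2)[OF assms(1), of "int j" "int n + 1"]
        that assms(2) top by auto
    then obtain u where u: "\<gamma> (int j) = cls b t 0 u"
      using segment linesD(1)[OF assms(1)] by metis
    show ?thesis using that by (simp add: roll_def u the_cls)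
  qed
  have "mono_on {..n+1} (roll n \<gamma>)"
  proof (rule mono_onI)
    fix i j assume "i \<in> {..n+1}" "j \<in> {..n+1}" "i \<le> j"
    then have "G_le (cls b t 0 (roll n \<gamma> i)) (cls b t 0 (roll n \<gamma> j))"
      using roll linesD(2)[OF assms(1), of "int i" "int j"] by simp
    then show "roll n \<gamma> i \<le> roll n \<gamma> j" by (simp add: G_le_cls_iff)
  qed
  moreover have "roll n \<gamma> 0 = b"
    using roll[of 0] assms(2) b_neq_t by (simp add: cc_def cls_eq_iff)
  moreover have "roll n \<gamma> (n + 1) = t"
    using roll[of "n + 1"] top b_neq_t by (simp add: cc_def cls_eq_iff add.commute)
  ultimately show "roll n \<gamma> \<in> seqs b t n"
    by (simp add: seqs_def roll_def)
  show "unroll b t n (roll n \<gamma>) = \<gamma>"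
  proof
    fix x
    obtain i where i: "i \<le> n" "unroll b t n (roll n \<gamma>) x = cls b t (x div (int n + 1)) (roll n \<gamma> i)"
      "x = int i + x div (int n + 1) * (int n + 1)" by (rule unroll_eq)
    have "\<gamma> x = shift (x div (int n + 1)) (\<gamma> (int i))"
      by (subst i(3)) (rule linesD(3)[OF assms(1)])
    also have "\<dots> = cls b t (x div (int n + 1)) (roll n \<gamma> i)"
      using i(1) by (simp flip: roll)
    finally show "unroll b t n (roll n \<gamma>) x = \<gamma> x" using i(2) by simp
  qed
qed

section \<open>Finitely many points on one periodic sequence\<close>

text \<open>The sequence enumerates \<open>S\<close> together with \<open>b\<close> and
  \<open>t\<close> in increasing order.\<close>

lemma strict_seq_through:
  assumes "finite S"
  obtains n \<beta> where "\<beta> \<in> seqs b t n" "strict_mono_on {..n+1} \<beta>" "S \<subseteq> \<beta> ` {..n+1}"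
proof -
  define xs where "xs = sorted_list_of_set (S \<union> {b, t})"
  have xs: "sorted_wrt (<) xs" "set xs = S \<union> {b, t}"
    unfolding xs_def using assms by (simp_all only: strict_sorted_list_of_set set_sorted_list_of_set finite_Un finite.intros simp_thms)
  have "card (set xs) \<ge> card {b, t}"
    unfolding xs(2) by (rule card_mono) (use assms in auto)
  then have len: "length xs \<ge> 2"
    using card_length[of xs] b_neq_t by simp
  \<comment> \<open>A sequence in degree \<open>n\<close> has \<open>n + 2\<close> entries; since
    \<open>b\<close> and \<open>t\<close> differ, the subtraction does not truncate.\<close>
  define n where "n = length xs - 2"
  have n: "length xs = n + 2" using len by (simp add: n_def)
  define \<beta> where "\<beta> = (\<lambda>j\<in>{..n+1}. xs ! j)"
  have strict: "strict_mono_on {..n+1} \<beta>"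
    using sorted_wrt_nth_less[OF xs(1)] by (auto simp: strict_mono_on_def \<beta>_def n)
  have image: "\<beta> ` {..n+1} = S \<union> {b, t}"
  proof -
    have "\<beta> ` {..n+1} = (!) xs ` {..<length xs}"
      by (rule image_cong) (auto simp: \<beta>_def n)
    also have "\<dots> = set xs"
      by (auto simp: set_conv_nth)
    finally show ?thesis using xs(2) by simp
  qed
  have mono: "mono_on {..n+1} \<beta>" using strict by (rule strict_mono_on_imp_mono_on)
  have "\<beta> 0 = b"
  proof -
    obtain i where "i \<le> n + 1" "\<beta> i = b" using image by (metis (no_types, lifting) UnI2 atMost_iff imageE insertCI)
    then show ?thesis using mono_onD[OF mono, of 0 i] b_least[of "\<beta> 0"] by auto
  qed
  moreover have "\<beta> (n + 1) = t"
  proof -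
    obtain i where "i \<le> n + 1" "\<beta> i = t" using image by (metis (no_types, lifting) UnI2 atMost_iff imageE insertCI)
    then show ?thesis using mono_onD[OF mono, of i "n + 1"] t_greatest[of "\<beta> (n + 1)"] by auto
  qed
  ultimately have "\<beta> \<in> seqs b t n" using mono by (simp add: seqs_def \<beta>_def)
  then show ?thesis using that strict image by blast
qed

text \<open>Strictness keeps the entries with index at most \<open>n\<close> different from
  \<open>t\<close>, so the gluing never identifies values from different periods.\<close>

lemma unroll_inj:
  assumes "\<beta> \<in> seqs b t n" "strict_mono_on {..n+1} \<beta>"
  shows "inj (unroll b t n \<beta>)"
proof (rule injI)
  fix x y assume eq: "unroll b t n \<beta> x = unroll b t n \<beta> y"
  obtain i where i: "i \<le> n" "unroll b t n \<beta> x = cls b t (x div (int n + 1)) (\<beta> i)"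
    "x = int i + x div (int n + 1) * (int n + 1)" by (rule unroll_eq)
  obtain j where j: "j \<le> n" "unroll b t n \<beta> y = cls b t (y div (int n + 1)) (\<beta> j)"
    "y = int j + y div (int n + 1) * (int n + 1)" by (rule unroll_eq)
  have "\<beta> l < \<beta> (n + 1)" if "l \<le> n" for l
    by (rule strict_mono_onD[OF assms(2)]) (use that in auto)
  then have "\<beta> i \<noteq> t" "\<beta> j \<noteq> t"
    using i(1) j(1) assms(1) by (fastforce simp: seqs_def)+
  then have eqs: "x div (int n + 1) = y div (int n + 1)" "\<beta> i = \<beta> j"
    using eq unfolding i(2) j(2) cls_eq_iff by auto
  have "i = j"
    using eqs(2) i(1) j(1) strict_mono_on_eqD[OF assms(2), of i j] by auto
  then show "x = y" using i(3) j(3) eqs(1) by simp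
qed

text \<open>If \<open>X = (k, u)\<close> and \<open>u\<close> is entry \<open>j\<close> of the
  sequence, then \<open>X\<close> is the value of the periodic extension at
  \<open>j + k(n + 1)\<close>. So it is enough to pass through all second components.\<close>

lemma line_through:
  assumes "finite A" "A \<subseteq> Gset b t"
  obtains n \<beta> where "\<beta> \<in> seqs b t n" "A \<subseteq> range (unroll b t n \<beta>)"
proof -
  have "\<forall>X\<in>A. \<exists>k u. X = cls b t k u"
    by (metis Gset_cases assms(2) subsetD)
  then obtain k u where ku: "\<And>X. X \<in> A \<Longrightarrow> X = cls b t (k X) (u X)"
    by metis
  obtain n \<beta> where \<beta>: "\<beta> \<in> seqs b t n" "u ` A \<subseteq> \<beta> ` {..n+1}"
    using strict_seq_through[OF finite_imageI[OF assms(1)], of u] by metis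
  have "X \<in> range (unroll b t n \<beta>)" if X: "X \<in> A" for X
  proof -
    obtain j where j: "j \<le> n + 1" "u X = \<beta> j" using \<beta>(2) X by auto
    have "unroll b t n \<beta> (int j + k X * (int n + 1)) = X"
      using linesD(3)[OF unroll_lines[OF \<beta>(1)], of "int j" "k X"] unroll_of_nat[OF \<beta>(1) j(1)]
        j(2) ku[OF X] by simp
    then show ?thesis by (metis rangeI)
  qed
  then show ?thesis using that[OF \<beta>(1)] by blast
qed

lemma line_through3:
  assumes "x \<in> Gset b t" "y \<in> Gset b t" "z \<in> Gset b t"
  obtains n \<beta> k l m where "\<beta> \<in> seqs b t n"
    "x = unroll b t n \<beta> k" "y = unroll b t n \<beta> l" "z = unroll b t n \<beta> m"
proof -
  have "finite {x, y, z}" "{x, y, z} \<subseteq> Gset b t" using assms by simp_all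
  then obtain n \<beta> where \<beta>: "\<beta> \<in> seqs b t n" "{x, y, z} \<subseteq> range (unroll b t n \<beta>)"
    using line_through by metis
  then have "x \<in> range (unroll b t n \<beta>)" "y \<in> range (unroll b t n \<beta>)" "z \<in> range (unroll b t n \<beta>)"
    by simp_all
  then show ?thesis using that[OF \<beta>(1)] by (elim rangeE)
qed

end

section \<open>From group laws to cyclic structures\<close>

context interval
begin

text \<open>For arrows from \<Delta>, precomposition with the transpose already is the action of the
  point functor: the base point is kept, and no group law intervenes.\<close>

lemma roll_unroll_transp:
  assumes "f \<in> Mor Delta n m" "\<beta> \<in> seqs b t n"
  shows "roll m (unroll b t n \<beta> \<circ> transp (periodic_ext n m f)) =
    (\<lambda>j\<in>{..m+1}. \<beta> (upper_star n f j))"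
  unfolding roll_def
proof (rule restrict_ext)
  fix j assume "j \<in> {..m+1}"
  then have "(unroll b t n \<beta> \<circ> transp (periodic_ext n m f)) (int j) = cls b t 0 (\<beta> (upper_star n f j))"
    using transp_periodic_ext[OF assms(1), of j] unroll_of_nat[OF assms(2) upper_star_range] by simp
  then show "(THE u. cls b t 0 u = (unroll b t n \<beta> \<circ> transp (periodic_ext n m f)) (int j)) =
      \<beta> (upper_star n f j)"
    by (simp only: the_cls)
qed

section \<open>Left translation of periodic sequences to the base point\<close>

lemma group_lawsD:
  assumes "M \<in> group_laws b t"
  shows "group M" "carrier M = Gset b t"
    "\<not> (x \<in> Gset b t \<and> y \<in> Gset b t) \<Longrightarrow> x \<otimes>\<^bsub>M\<^esub> y = undefined"
    "g \<in> Gset b t \<Longrightarrow> x \<in> Gset b t \<Longrightarrow> y \<in> Gset b t \<Longrightarrow> G_le x y \<Longrightarrow>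
      G_le (g \<otimes>\<^bsub>M\<^esub> x) (g \<otimes>\<^bsub>M\<^esub> y)"
    "x \<in> Gset b t \<Longrightarrow> cc b t k \<otimes>\<^bsub>M\<^esub> x = shift k x"
    "x \<in> Gset b t \<Longrightarrow> x \<otimes>\<^bsub>M\<^esub> cc b t k = shift k x"
  using assms by (auto simp: group_laws_def add.commute elim!: Gset_cases)

lemma cc_in_Gset: "cc b t k \<in> Gset b t"
  by (simp add: cc_def cls_in_Gset)

text \<open>Condition (ii) makes \<open>c(0)\<close> idempotent, and a group has only one
  idempotent.\<close>

lemma group_laws_one:
  assumes "M \<in> group_laws b t"
  shows "\<one>\<^bsub>M\<^esub> = cc b t 0"
proof -
  interpret group M by (rule group_lawsD[OF assms])
  have "cc b t 0 \<otimes>\<^bsub>M\<^esub> cc b t 0 = cc b t 0"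
    using group_lawsD(5)[OF assms cc_in_Gset] shift_0[OF cc_in_Gset] by simp
  then show ?thesis
    using l_cancel_one[of "cc b t 0" "cc b t 0"] cc_in_Gset group_lawsD(2)[OF assms] by simp
qed

definition based :: "(int \<times> 'i) set monoid \<Rightarrow> (int \<Rightarrow> (int \<times> 'i) set) \<Rightarrow> int \<Rightarrow> (int \<times> 'i) set" where
  "based M \<gamma> x = inv\<^bsub>M\<^esub> (\<gamma> 0) \<otimes>\<^bsub>M\<^esub> \<gamma> x"

lemma cyclic_act_eq: "cyclic_act b t M n m f \<beta> = roll m (based M (unroll b t n \<beta> \<circ> transp f))"
  by (simp add: cyclic_act_def roll_def based_def Let_def)

text \<open>Both conditions on the group law enter here: left invariance keeps the translate
  monotone, and centrality of \<open>c(k)\<close> keeps it periodic.\<close>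

lemma based_lines:
  assumes "M \<in> group_laws b t" "\<gamma> \<in> lines n"
  shows "based M \<gamma> \<in> lines n" "based M \<gamma> 0 = cc b t 0"
proof -
  interpret group M by (rule group_lawsD[OF assms(1)])
  note M = group_lawsD[OF assms(1)]
  have G: "\<gamma> x \<in> carrier M" for x using linesD(1)[OF assms(2)] M(2) by simp
  show "based M \<gamma> 0 = cc b t 0" unfolding based_def using G group_laws_one[OF assms(1)] by simp
  have "based M \<gamma> (x + k * (int n + 1)) = shift k (based M \<gamma> x)" for x k
  proof -
    define g where "g = inv\<^bsub>M\<^esub> (\<gamma> 0)"
    have g: "g \<in> carrier M" unfolding g_def using G by simp
    have c: "cc b t k \<in> carrier M" using cc_in_Gset M(2) by simp
    have "g \<otimes>\<^bsub>M\<^esub> shift k (\<gamma> x) = g \<otimes>\<^bsub>M\<^esub> (cc b t k \<otimes>\<^bsub>M\<^esub> \<gamma> x)"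
      using M(2,5) G by simp
    also have "\<dots> = (g \<otimes>\<^bsub>M\<^esub> cc b t k) \<otimes>\<^bsub>M\<^esub> \<gamma> x"
      using g c G by (simp add: m_assoc)
    also have "\<dots> = (cc b t k \<otimes>\<^bsub>M\<^esub> g) \<otimes>\<^bsub>M\<^esub> \<gamma> x"
      using M(2,5,6) g by simp
    also have "\<dots> = cc b t k \<otimes>\<^bsub>M\<^esub> (g \<otimes>\<^bsub>M\<^esub> \<gamma> x)"
      using g c G by (simp add: m_assoc)
    also have "\<dots> = shift k (g \<otimes>\<^bsub>M\<^esub> \<gamma> x)"
      using M(2,5) g G m_closed by metis
    finally show ?thesis by (simp add: based_def g_def linesD(3)[OF assms(2)])
  qed
  moreover have "based M \<gamma> x \<in> Gset b t" for x
    using G inv_closed m_closed unfolding based_def M(2)[symmetric] by blast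
  moreover have "G_le (based M \<gamma> x) (based M \<gamma> y)" if "x \<le> y" for x y
    unfolding based_def
    by (rule M(4)) (use G inv_closed M(2) linesD(2)[OF assms(2) that] in auto)
  ultimately show "based M \<gamma> \<in> lines n" by (simp add: lines_def)
qed

text \<open>A common left factor cancels in the quotients. This gives independence of the
  representative of an arrow as well as compatibility with composition.\<close>

lemma based_translate:
  assumes "M \<in> group_laws b t" "g \<in> Gset b t" "\<And>x. \<gamma> x \<in> Gset b t"
  shows "based M (\<lambda>x. g \<otimes>\<^bsub>M\<^esub> \<gamma> x) = based M \<gamma>"
proof -
  interpret group M by (rule group_lawsD[OF assms(1)])
  have G: "\<gamma> x \<in> carrier M" "g \<in> carrier M" for x
    using assms(2,3) group_lawsD(2)[OF assms(1)] by auto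
  have "inv\<^bsub>M\<^esub> (g \<otimes>\<^bsub>M\<^esub> \<gamma> 0) \<otimes>\<^bsub>M\<^esub> (g \<otimes>\<^bsub>M\<^esub> \<gamma> x) = inv\<^bsub>M\<^esub> (\<gamma> 0) \<otimes>\<^bsub>M\<^esub> \<gamma> x" for x
    using G by (simp add: inv_mult_group m_assoc) (simp add: m_assoc[symmetric])
  then show ?thesis by (simp add: based_def fun_eq_iff)
qed

lemma based_ident:
  assumes "M \<in> group_laws b t" "\<gamma> 0 = cc b t 0" "\<And>x. \<gamma> x \<in> Gset b t"
  shows "based M \<gamma> = \<gamma>"
proof -
  interpret group M by (rule group_lawsD[OF assms(1)])
  have "\<gamma> x \<in> carrier M" for x
    using assms(3) group_lawsD(2)[OF assms(1)] by auto
  then show ?thesis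
    by (simp add: based_def fun_eq_iff assms(2) flip: group_laws_one[OF assms(1)])
qed

lemma Ob_cyclic_of_group [simp]: "Ob (cyclic_of_group b t M) = seqs b t"
  by (simp add: cyclic_of_group_def)

lemma Ar_cyclic_of_group:
  assumes "M \<in> group_laws b t" "f \<in> cyclic_maps n m" "\<beta> \<in> seqs b t n"
  shows "Ar (cyclic_of_group b t M) n m (Lambda_class n m f) \<beta> =
    roll m (based M (unroll b t n \<beta> \<circ> transp f))"
proof -
  obtain k where k: "(SOME g. g \<in> Lambda_class n m f) = (\<lambda>x. f x + k * (int m + 1))"
    using Lambda_class_some[OF assms(2)] .
  note \<gamma> = unroll_lines[OF assms(3)]
  \<comment> \<open>Adding \<open>k(m + 1)\<close> to \<open>f\<close> lowers its transpose by
    \<open>k(n + 1)\<close>, hence multiplies the values by \<open>c(-k)\<close>.\<close>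
  have "(unroll b t n \<beta> \<circ> transp (\<lambda>x. f x + k * (int m + 1))) y =
      cc b t (- k) \<otimes>\<^bsub>M\<^esub> (unroll b t n \<beta> \<circ> transp f) y" for y
    using cyclic_maps_shift[OF transp_cyclic_maps[OF assms(2)], of y "- k"]
      linesD(3)[OF \<gamma>, of "transp f y" "- k"] group_lawsD(5)[OF assms(1) linesD(1)[OF \<gamma>]]
    by (simp add: transp_add(1)[OF assms(2)])
  then have "based M (unroll b t n \<beta> \<circ> transp (\<lambda>x. f x + k * (int m + 1))) =
      based M (unroll b t n \<beta> \<circ> transp f)"
    using based_translate[OF assms(1) cc_in_Gset, of "unroll b t n \<beta> \<circ> transp f" "- k"]
      linesD(1)[OF \<gamma>] by (simp add: fun_eq_iff based_def)
  then show ?thesis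
    unfolding cyclic_of_group_def to_sets.simps k cyclic_act_eq
    using assms(3) Lambda_class_Mor[OF assms(2)] by simp
qed

lemma unroll_Ar_cyclic_of_group:
  assumes "M \<in> group_laws b t" "f \<in> cyclic_maps n m" "\<beta> \<in> seqs b t n"
  shows "Ar (cyclic_of_group b t M) n m (Lambda_class n m f) \<beta> \<in> seqs b t m"
    and "unroll b t m (Ar (cyclic_of_group b t M) n m (Lambda_class n m f) \<beta>) =
      based M (unroll b t n \<beta> \<circ> transp f)"
proof -
  note \<gamma> = lines_comp[OF unroll_lines[OF assms(3)] transp_cyclic_maps[OF assms(2)]]
  note roll = roll_lines[OF based_lines[OF assms(1) \<gamma>]]
  show "Ar (cyclic_of_group b t M) n m (Lambda_class n m f) \<beta> \<in> seqs b t m"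
    "unroll b t m (Ar (cyclic_of_group b t M) n m (Lambda_class n m f) \<beta>) =
      based M (unroll b t n \<beta> \<circ> transp f)"
    unfolding Ar_cyclic_of_group[OF assms] by (rule roll)+
qed

lemma cyclic_of_group_functor:
  assumes M: "M \<in> group_laws b t"
  shows "is_functor Lambda (cyclic_of_group b t M)"
proof -
  define F where "F = cyclic_of_group b t M"
  have ob: "Ob F = seqs b t" by (simp add: F_def)
  have ext: "Ar F n m \<phi> \<in> extensional (seqs b t n)" if "\<phi> \<in> Mor Lambda n m" for n m \<phi>
    using that by (simp add: F_def cyclic_of_group_def)
  have maps: "Ar F n m \<phi> \<in> seqs b t n \<rightarrow>\<^sub>E seqs b t m" if \<phi>: "\<phi> \<in> Mor Lambda n m" for n m \<phi>
  proof -
    obtain f where "f \<in> cyclic_maps n m" "\<phi> = Lambda_class n m f" using Lambda_Mor_cases[OF \<phi>] .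
    then show ?thesis
      using ext[OF \<phi>] unroll_Ar_cyclic_of_group(1)[OF M] by (simp add: F_def PiE_def Pi_def)
  qed
  have undef: "Ar F n m \<phi> = undefined" if "\<phi> \<notin> Mor Lambda n m" for n m \<phi>
    using that by (simp add: F_def cyclic_of_group_def)
  have id_cyc: "id \<in> cyclic_maps n n" for n by (simp add: cyclic_maps_def mono_def)
  have Ident: "Ident Lambda n = Lambda_class n n id" for n by (simp add: Lambda_def)
  have ident: "Ar F n n (Ident Lambda n) = restrict id (seqs b t n)" for n
  proof (rule extensionalityI[OF ext])
    show "Ident Lambda n \<in> Mor Lambda n n" by (simp add: Ident Lambda_class_Mor id_cyc)
    fix \<beta> assume \<beta>: "\<beta> \<in> seqs b t n"
    have "based M (unroll b t n \<beta>) = unroll b t n \<beta>"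
      using based_ident[OF M] unroll_0[OF \<beta>] linesD(1)[OF unroll_lines[OF \<beta>]] by blast
    then show "Ar F n n (Ident Lambda n) \<beta> = restrict id (seqs b t n) \<beta>"
      using Ar_cyclic_of_group[OF M id_cyc \<beta>] roll_unroll[OF \<beta>] \<beta> by (simp add: F_def Ident)
  qed simp
  have comp: "Ar F n k (Comp Lambda n m k \<psi> \<phi>) = compose (seqs b t n) (Ar F m k \<psi>) (Ar F n m \<phi>)"
    if \<phi>: "\<phi> \<in> Mor Lambda n m" and \<psi>: "\<psi> \<in> Mor Lambda m k" for n m k \<phi> \<psi>
  proof -
    obtain f where f: "f \<in> cyclic_maps n m" "\<phi> = Lambda_class n m f" using Lambda_Mor_cases[OF \<phi>] .
    obtain g where g: "g \<in> cyclic_maps m k" "\<psi> = Lambda_class m k g" using Lambda_Mor_cases[OF \<psi>] .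
    have gf: "Comp Lambda n m k \<psi> \<phi> = Lambda_class n k (g \<circ> f)"
      using Lambda_Comp_class[OF f(1) g(1)] f g by simp
    note gf_cyc = cyclic_maps_comp[OF f(1) g(1)]
    show ?thesis unfolding gf
    proof (rule extensionalityI[OF ext[OF Lambda_class_Mor[OF gf_cyc]]])
      fix \<beta> assume \<beta>: "\<beta> \<in> seqs b t n"
      define \<gamma> where "\<gamma> = unroll b t n \<beta> \<circ> transp f"
      have \<gamma>: "\<gamma> \<in> lines m"
        unfolding \<gamma>_def using lines_comp[OF unroll_lines[OF \<beta>] transp_cyclic_maps[OF f(1)]] .
      have inv: "inv\<^bsub>M\<^esub> (\<gamma> 0) \<in> Gset b t"
        using group.inv_closed[OF group_lawsD(1)[OF M], of "\<gamma> 0"] linesD(1)[OF \<gamma>]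
          group_lawsD(2)[OF M] by simp
      \<comment> \<open>The normalisation after the first arrow is a left translation, which the
        second normalisation absorbs.\<close>
      have "based M (based M \<gamma> \<circ> transp g) = based M (\<gamma> \<circ> transp g)"
        using based_translate[OF M inv, of "\<gamma> \<circ> transp g"] linesD(1)[OF \<gamma>]
        by (simp add: based_def[of M \<gamma>] comp_def)
      then have "Ar F m k \<psi> (Ar F n m \<phi> \<beta>) = Ar F n k (Lambda_class n k (g \<circ> f)) \<beta>"
        using Ar_cyclic_of_group[OF M gf_cyc \<beta>] unroll_Ar_cyclic_of_group[OF M f(1) \<beta>]
          Ar_cyclic_of_group[OF M g(1) unroll_Ar_cyclic_of_group(1)[OF M f(1) \<beta>]]
        by (simp add: F_def f(2) g(2) \<gamma>_def transp_comp[OF f(1) g(1)] comp_assoc)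
      then show "Ar F n k (Lambda_class n k (g \<circ> f)) \<beta> =
          compose (seqs b t n) (Ar F m k \<psi>) (Ar F n m \<phi>) \<beta>"
        using \<beta> by (simp add: compose_def)
    qed (simp add: compose_extensional)
  qed
  show ?thesis
    unfolding is_functor_def F_def[symmetric] ob
    by (intro conjI allI ballI impI maps undef ident comp)
qed

lemma comp_j_cyclic_of_group:
  assumes M: "M \<in> group_laws b t"
  shows "comp_j (cyclic_of_group b t M) = point_functor b t"
proof -
  have "Ar (cyclic_of_group b t M) n m (incl_j n m f) =
      (\<lambda>\<beta>\<in>seqs b t n. \<lambda>j\<in>{..m+1}. \<beta> (upper_star n f j))" if f: "f \<in> Mor Delta n m" for n m f
  proof (rule extensionalityI)
    show "Ar (cyclic_of_group b t M) n m (incl_j n m f) \<in> extensional (seqs b t n)"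
      using incl_j_Mor[OF f] by (simp add: cyclic_of_group_def)
    fix \<beta> assume \<beta>: "\<beta> \<in> seqs b t n"
    \<comment> \<open>Hence the value at \<open>0\<close> is still \<open>c(0)\<close>, the unit,
      and normalising changes nothing.\<close>
    have "transp (periodic_ext n m f) 0 = 0"
      using transp_periodic_ext[OF f, of 0] upper_star_ends(1)[OF f] by simp
    then have "based M (unroll b t n \<beta> \<circ> transp (periodic_ext n m f)) =
        unroll b t n \<beta> \<circ> transp (periodic_ext n m f)"
      using based_ident[OF M] unroll_0[OF \<beta>] linesD(1)[OF unroll_lines[OF \<beta>]] by simp
    then show "Ar (cyclic_of_group b t M) n m (incl_j n m f) \<beta> =
        (\<lambda>\<beta>\<in>seqs b t n. \<lambda>j\<in>{..m+1}. \<beta> (upper_star n f j)) \<beta>"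
      using Ar_cyclic_of_group[OF M periodic_ext_cyclic[OF f] \<beta>] roll_unroll_transp[OF f \<beta>] \<beta>
      by (simp add: incl_j_def)
  qed simp
  then show ?thesis
    by (auto simp: comp_j_def point_functor_def fun_eq_iff)
qed

lemma cyclic_of_group_in_cyclic_structures:
  "M \<in> group_laws b t \<Longrightarrow> cyclic_of_group b t M \<in> cyclic_structures b t"
  by (simp add: cyclic_structures_def cyclic_of_group_functor comp_j_cyclic_of_group)

section \<open>Recovering the group law from its cyclic structure\<close>

text \<open>The transpose of translation by \<open>- k\<close> is translation by \<open>k\<close>.
  So this rotation makes the place \<open>k\<close> the base point, and normalising divides by the
  value there on the left.\<close>

lemma quotient_from_rotation:
  assumes "M \<in> group_laws b t" "\<beta> \<in> seqs b t n"
  shows "inv\<^bsub>M\<^esub> (unroll b t n \<beta> k) \<otimes>\<^bsub>M\<^esub> unroll b t n \<beta> l =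
    unroll b t n (Ar (cyclic_of_group b t M) n n (Lambda_class n n (\<lambda>x. x + - k)) \<beta>) (l - k)"
  using unroll_Ar_cyclic_of_group(2)[OF assms(1) translation_cyclic_maps assms(2), of "- k"]
  by (simp add: based_def transp_translation del: add_uminus_conv_diff)

text \<open>Taking \<open>y\<close> to be the common unit \<open>c(0)\<close> identifies the
  inverses, and then products are the quotients of \<open>x\<inverse>\<close> and \<open>y\<close>.
  Off the carrier both products are \<open>undefined\<close>, so the records agree.\<close>

lemma group_laws_eqI:
  assumes M: "M \<in> group_laws b t" and M': "M' \<in> group_laws b t"
    and eq: "\<And>x y. x \<in> Gset b t \<Longrightarrow> y \<in> Gset b t \<Longrightarrow>
      inv\<^bsub>M\<^esub> x \<otimes>\<^bsub>M\<^esub> y = inv\<^bsub>M'\<^esub> x \<otimes>\<^bsub>M'\<^esub> y"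
  shows "M = M'"
proof -
  interpret M: group M by (rule group_lawsD[OF M])
  interpret M': group M' by (rule group_lawsD[OF M'])
  note carr = group_lawsD(2)[OF M] group_lawsD(2)[OF M']
  note one = group_laws_one[OF M] group_laws_one[OF M']
  have inv: "inv\<^bsub>M\<^esub> x = inv\<^bsub>M'\<^esub> x" if "x \<in> Gset b t" for x
    using eq[OF that cc_in_Gset, of 0] that M.r_one[of "inv\<^bsub>M\<^esub> x"] M'.r_one[of "inv\<^bsub>M'\<^esub> x"]
      M.inv_closed[of x] M'.inv_closed[of x]
    by (simp add: carr one)
  have "x \<otimes>\<^bsub>M\<^esub> y = x \<otimes>\<^bsub>M'\<^esub> y" if xy: "x \<in> Gset b t" "y \<in> Gset b t" for x y
  proof -
    have ix: "inv\<^bsub>M\<^esub> x \<in> Gset b t" using M.inv_closed xy carr by blast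
    have "inv\<^bsub>M\<^esub> (inv\<^bsub>M\<^esub> x) = x" using xy carr by simp
    moreover have "inv\<^bsub>M'\<^esub> (inv\<^bsub>M\<^esub> x) = x"
      unfolding inv[OF xy(1)] using xy carr by simp
    ultimately show ?thesis using eq[OF ix xy(2)] by simp
  qed
  then have "x \<otimes>\<^bsub>M\<^esub> y = x \<otimes>\<^bsub>M'\<^esub> y" for x y
    using group_lawsD(3)[OF M, of x y] group_lawsD(3)[OF M', of x y] by metis
  then have "mult M = mult M'" by (intro ext)
  then show ?thesis using carr one by (intro monoid.equality) simp_all
qed

lemma inj_on_cyclic_of_group: "inj_on (cyclic_of_group b t) (group_laws b t)"
proof (rule inj_onI)
  fix M M' assume M: "M \<in> group_laws b t" and M': "M' \<in> group_laws b t"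
    and eq: "cyclic_of_group b t M = cyclic_of_group b t M'"
  show "M = M'"
  proof (rule group_laws_eqI[OF M M'])
    fix x y assume xy: "x \<in> Gset b t" "y \<in> Gset b t"
    obtain n \<beta> k l where \<beta>: "\<beta> \<in> seqs b t n" "x = unroll b t n \<beta> k" "y = unroll b t n \<beta> l"
      using line_through3[OF xy xy(2)] by metis
    then show "inv\<^bsub>M\<^esub> x \<otimes>\<^bsub>M\<^esub> y = inv\<^bsub>M'\<^esub> x \<otimes>\<^bsub>M'\<^esub> y"
      using quotient_from_rotation[OF M \<beta>(1), of k l] quotient_from_rotation[OF M' \<beta>(1), of k l] eq
      by simp
  qed
qed

end

section \<open>From cyclic structures to group laws\<close>

text \<open>With \<open>d x y\<close> read as \<open>x\<inverse> y\<close>, the inverse of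
  \<open>x\<close> is \<open>d x e\<close> and the product is \<open>d (d x e) y\<close>.\<close>

lemma group_of_division:
  fixes d :: "'a \<Rightarrow> 'a \<Rightarrow> 'a"
  assumes e: "e \<in> S"
    and closed: "\<And>x y. x \<in> S \<Longrightarrow> y \<in> S \<Longrightarrow> d x y \<in> S"
    and left: "\<And>x. x \<in> S \<Longrightarrow> d e x = x"
    and self: "\<And>x. x \<in> S \<Longrightarrow> d x x = e"
    and cancel: "\<And>x y z. x \<in> S \<Longrightarrow> y \<in> S \<Longrightarrow> z \<in> S \<Longrightarrow> d (d x y) (d x z) = d y z"
  defines "M \<equiv> \<lparr>carrier = S, mult = (\<lambda>x y. if x \<in> S \<and> y \<in> S then d (d x e) y else undefined), one = e\<rparr>"
  shows "group M" and "\<And>x y. x \<in> S \<Longrightarrow> y \<in> S \<Longrightarrow> inv\<^bsub>M\<^esub> x \<otimes>\<^bsub>M\<^esub> y = d x y"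
proof -
  have inv_inv: "d (d x e) e = x" if "x \<in> S" for x
    using cancel[OF that e that] self[OF that] left[OF that] by simp
  have inv_d: "d (d x y) e = d y x" if "x \<in> S" "y \<in> S" for x y
    using cancel[OF that that(1)] self[OF that(1)] by simp
  \<comment> \<open>In group notation, \<open>y\<inverse> (y z) = z\<close>.\<close>
  have undo: "d y (d (d y e) z) = z" if "y \<in> S" "z \<in> S" for y z
    using cancel[of "d y e" e "d (d y e) z"] cancel[of "d y e" e z] that e closed left inv_inv
    by (metis cancel)
  have mult: "x \<otimes>\<^bsub>M\<^esub> y = d (d x e) y" if "x \<in> S" "y \<in> S" for x y
    using that by (simp add: M_def)
  have carrier: "carrier M = S" and one: "\<one>\<^bsub>M\<^esub> = e"
    by (simp_all add: M_def)
  show group: "group M"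
  proof (rule groupI)
    fix x y z assume "x \<in> carrier M" "y \<in> carrier M" "z \<in> carrier M"
    then have xyz: "x \<in> S" "y \<in> S" "z \<in> S" by (simp_all add: carrier)
    \<comment> \<open>This is \<open>(x y) z\<close>, whose divisor \<open>(x y)\<inverse>\<close>
      is rewritten as \<open>y\<inverse> x\<inverse>\<close>. Writing \<open>z\<close> as
      \<open>y\<inverse> (y z)\<close> then lets \<open>cancel\<close> remove
      \<open>y\<close>.\<close>
    have "d (d (d (d x e) y) e) z = d (d y (d x e)) z"
      using inv_d xyz e closed by simp
    also have "\<dots> = d (d y (d x e)) (d y (d (d y e) z))"
      using undo[OF xyz(2,3)] by simp
    also have "\<dots> = d (d x e) (d (d y e) z)"
      using cancel xyz e closed by simp
    finally show "x \<otimes>\<^bsub>M\<^esub> y \<otimes>\<^bsub>M\<^esub> z = x \<otimes>\<^bsub>M\<^esub> (y \<otimes>\<^bsub>M\<^esub> z)"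
      using xyz e closed by (simp add: mult)
  next
    fix x assume "x \<in> carrier M"
    then have x: "x \<in> S" by (simp add: carrier)
    show "\<one>\<^bsub>M\<^esub> \<otimes>\<^bsub>M\<^esub> x = x" using x e left by (simp add: one mult)
    show "\<exists>y\<in>carrier M. y \<otimes>\<^bsub>M\<^esub> x = \<one>\<^bsub>M\<^esub>"
      using x e closed inv_inv self by (auto simp: carrier one mult intro!: bexI[of _ "d x e"])
  qed (use e closed in \<open>auto simp: carrier one mult\<close>)
  fix x y assume xy: "x \<in> S" "y \<in> S"
  have "inv\<^bsub>M\<^esub> x = d x e"
    by (rule group.inv_equality[OF group])
      (use xy e closed inv_inv self in \<open>auto simp: carrier one mult\<close>)
  then show "inv\<^bsub>M\<^esub> x \<otimes>\<^bsub>M\<^esub> y = d x y"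
    using xy e closed inv_inv by (simp add: mult)
qed

text \<open>For \<open>j \<le> m\<close>, \<open>f i \<ge> j\<close> holds iff
  \<open>\<beta>' j \<le> \<beta> i\<close>. So \<open>f\<^sup>*(j)\<close> is the first place where
  \<beta> reaches \<open>\<beta>' j\<close>, and the value there is exactly
  \<open>\<beta>' j\<close> because \<beta> attains it.\<close>

lemma (in interval) seqs_refine:
  assumes \<beta>: "\<beta> \<in> seqs b t n" and \<beta>': "\<beta>' \<in> seqs b t m" and sub: "\<beta>' ` {..m+1} \<subseteq> \<beta> ` {..n+1}"
  obtains f where "f \<in> Mor Delta n m" "\<beta>' = (\<lambda>j\<in>{..m+1}. \<beta> (upper_star n f j))"
proof
  have mono: "\<beta> i \<le> \<beta> j" if "i \<le> j" "j \<le> n + 1" for i j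
    using \<beta> that by (auto simp: seqs_def mono_on_def)
  have mono': "\<beta>' i \<le> \<beta>' j" if "i \<le> j" "j \<le> m + 1" for i j
    using \<beta>' that by (auto simp: seqs_def mono_on_def)
  have ends: "\<beta> 0 = b" "\<beta> (n + 1) = t" "\<beta>' 0 = b" "\<beta>' (m + 1) = t"
    using \<beta> \<beta>' by (auto simp: seqs_def)
  \<comment> \<open>The index \<open>m + 1\<close> is left out so that \<open>f\<close> maps into
    \<open>[m]\<close>; \<open>0\<close> always belongs, since
    \<open>\<beta>' 0 = b\<close>.\<close>
  define A where "A i = {j. j \<le> m \<and> \<beta>' j \<le> \<beta> i}" for i
  define f where "f = (\<lambda>i\<in>{..n}. Max (A i))"
  have A: "finite (A i)" "0 \<in> A i" for i
    by (simp_all add: A_def ends b_least)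
  then have f: "f i \<in> A i" if "i \<le> n" for i
    using that Max_in[of "A i"] by (metis atMost_iff empty_iff f_def restrict_apply')
  have le_f: "j \<le> f i" if "i \<le> n" "j \<in> A i" for i j
    using that A by (simp add: f_def)
  have "f i \<le> f j" if "i \<le> j" "j \<le> n" for i j
    by (rule le_f) (use f[of i] mono[of i j] that in \<open>auto simp: A_def\<close>)
  then show Mor: "f \<in> Mor Delta n m"
    using f by (auto simp: Delta_def f_def mono_on_def A_def)
  show "\<beta>' = (\<lambda>j\<in>{..m+1}. \<beta> (upper_star n f j))"
  proof (rule extensionalityI[of _ "{..m+1}"])
    fix j assume "j \<in> {..m+1}"
    then have j: "j \<le> m + 1" by simp
    define u where "u = upper_star n f j"
    have "\<beta> u = \<beta>' j"
    proof (cases "j = m + 1")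
      case True
      then show ?thesis using upper_star_ends(2)[OF Mor] ends by (simp add: u_def)
    next
      case False
      then have jm: "j \<le> m" using j by simp
      have "\<beta>' j \<in> \<beta> ` {..n+1}"
        using j by (intro subsetD[OF sub] imageI) simp
      then obtain i where i: "i \<le> n + 1" "\<beta> i = \<beta>' j"
        by (metis atMost_iff imageE)
      have u_le: "u \<le> n + 1" unfolding u_def by (rule upper_star_range)
      have "u \<le> i"
      proof (cases "i \<le> n")
        case True
        then have "j \<le> f i" using le_f jm i(2) by (simp add: A_def)
        then show ?thesis using upper_star_le_iff[OF Mor True] by (simp add: u_def)
      qed (use u_le in simp)
      then have "\<beta> u \<le> \<beta>' j" using mono[of u i] i by simp
      moreover have "\<beta>' j \<le> \<beta> u"
      proof (cases "u \<le> n")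
        case True
        then have "j \<le> f u" using upper_star_le_iff[OF Mor True, of j] by (simp add: u_def)
        then show ?thesis using mono'[of j "f u"] f[OF True] by (auto simp: A_def)
      next
        case False
        then show ?thesis using u_le ends(2) t_greatest by (simp add: le_Suc_eq)
      qed
      ultimately show ?thesis by simp
    qed
    then show "\<beta>' j = (\<lambda>j\<in>{..m+1}. \<beta> (upper_star n f j)) j" using j by (simp add: u_def)
  qed (use \<beta>' in \<open>simp_all add: seqs_def PiE_def\<close>)
qed

section \<open>The action of a given cyclic structure\<close>

locale cyclic_structure = interval +
  fixes F
  assumes F: "F \<in> cyclic_structures b t"
begin

abbreviation act :: "nat \<Rightarrow> nat \<Rightarrow> (int \<Rightarrow> int) \<Rightarrow> (nat \<Rightarrow> 'a) \<Rightarrow> nat \<Rightarrow> 'a" where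
  "act n m f \<beta> \<equiv> Ar F n m (Lambda_class n m f) \<beta>"

lemma functorial: "is_functor Lambda F" and comp_j: "comp_j F = point_functor b t"
  using F by (simp_all add: cyclic_structures_def)

lemma Ob_eq: "Ob F = seqs b t"
  using arg_cong[OF comp_j, of Ob] by (simp add: comp_j_def point_functor_def)

lemma Ar_funcset: "\<phi> \<in> Mor Lambda n m \<Longrightarrow> Ar F n m \<phi> \<in> seqs b t n \<rightarrow>\<^sub>E seqs b t m"
  using functorial by (simp add: is_functor_def Ob_eq)

lemma act_seqs: "f \<in> cyclic_maps n m \<Longrightarrow> \<beta> \<in> seqs b t n \<Longrightarrow> act n m f \<beta> \<in> seqs b t m"
  using Ar_funcset[OF Lambda_class_Mor] by (auto simp: PiE_def)

lemma act_comp: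
  assumes "f \<in> cyclic_maps n m" "g \<in> cyclic_maps m k" "\<beta> \<in> seqs b t n"
  shows "act n k (g \<circ> f) \<beta> = act m k g (act n m f \<beta>)"
proof -
  have "Ar F n k (Comp Lambda n m k (Lambda_class m k g) (Lambda_class n m f)) =
      compose (Ob F n) (Ar F m k (Lambda_class m k g)) (Ar F n m (Lambda_class n m f))"
    using functorial Lambda_class_Mor[OF assms(1)] Lambda_class_Mor[OF assms(2)]
    unfolding is_functor_def by blast
  then show ?thesis
    using assms(3) by (simp add: Lambda_Comp_class[OF assms(1,2)] compose_def Ob_eq)
qed

lemma act_id: "\<beta> \<in> seqs b t n \<Longrightarrow> act n n id \<beta> = \<beta>"
  using functorial unfolding is_functor_def by (simp add: Lambda_def Ob_eq)

lemma act_incl_j: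
  assumes "f \<in> Mor Delta n m" "\<beta> \<in> seqs b t n"
  shows "act n m (periodic_ext n m f) \<beta> = (\<lambda>j\<in>{..m+1}. \<beta> (upper_star n f j))"
proof -
  have "Ar (comp_j F) n m f \<beta> = Ar (point_functor b t) n m f \<beta>" by (simp add: comp_j)
  then show ?thesis using assms by (simp add: comp_j_def point_functor_def incl_j_def)
qed

text \<open>Such an \<open>f\<close> comes from \<Delta>, where the action is prescribed by the
  point functor.\<close>

lemma unroll_act_Delta:
  assumes "f \<in> cyclic_maps n m" "transp f 0 = 0" "\<beta> \<in> seqs b t n"
  shows "unroll b t m (act n m f \<beta>) = unroll b t n \<beta> \<circ> transp f"
proof -
  obtain f\<^sub>0 where f\<^sub>0: "f\<^sub>0 \<in> Mor Delta n m" "f = periodic_ext n m f\<^sub>0"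
    using cyclic_maps_from_Delta[OF assms(1,2)] .
  have "act n m f \<beta> = roll m (unroll b t n \<beta> \<circ> transp f)"
    unfolding f\<^sub>0(2) act_incl_j[OF f\<^sub>0(1) assms(3)] roll_unroll_transp[OF f\<^sub>0(1) assms(3)] ..
  moreover have "unroll b t m (roll m (unroll b t n \<beta> \<circ> transp f)) = unroll b t n \<beta> \<circ> transp f"
    by (rule roll_lines(2)[OF lines_comp[OF unroll_lines transp_cyclic_maps]])
      (use assms unroll_0 in auto)
  ultimately show ?thesis by simp
qed

section \<open>Rotations and quotients along a sequence\<close>

text \<open>The sign makes the transpose translation by \<open>k\<close>, so the place
  \<open>k\<close> becomes the base point.\<close>

definition rot :: "nat \<Rightarrow> int \<Rightarrow> (nat \<Rightarrow> 'a) \<Rightarrow> nat \<Rightarrow> 'a" where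
  "rot n k = act n n (\<lambda>x. x + - k)"

lemma rot_seqs: "\<beta> \<in> seqs b t n \<Longrightarrow> rot n k \<beta> \<in> seqs b t n"
  unfolding rot_def by (rule act_seqs[OF translation_cyclic_maps])

lemma rot_0: "\<beta> \<in> seqs b t n \<Longrightarrow> rot n 0 \<beta> = \<beta>"
  using act_id by (simp add: rot_def id_def)

lemma rot_rot: "\<beta> \<in> seqs b t n \<Longrightarrow> rot n l (rot n k \<beta>) = rot n (k + l) \<beta>"
  using act_comp[OF translation_cyclic_maps[of "- k"] translation_cyclic_maps[of "- l"]]
  by (simp add: rot_def comp_def algebra_simps)

text \<open>A full turn of \<open>n + 1\<close> places is the identity arrow of \<Lambda>. This will
  make the subgroup \<open>c(\<int>)\<close> central.\<close>

lemma rot_period: "rot n (k + p * (int n + 1)) = rot n k"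
proof -
  have "(\<lambda>x. x + - k, \<lambda>x. x + - (k + p * (int n + 1))) \<in> shift_rel n n"
    unfolding shift_rel_iff[OF translation_cyclic_maps]
    by (rule exI[of _ "- p"]) (simp add: fun_eq_iff)
  then show ?thesis
    unfolding rot_def using equiv_class_eq[OF equiv_shift_rel] by (metis (no_types))
qed

text \<open>Every cyclic map is a rotation followed by a map in the image of \<open>j\<close>.\<close>

lemma unroll_act:
  assumes "f \<in> cyclic_maps n m" "\<beta> \<in> seqs b t n"
  shows "unroll b t m (act n m f \<beta>) x =
    unroll b t n (rot n (transp f 0) \<beta>) (transp f x - transp f 0)"
proof -
  define k where "k = transp f 0"
  \<comment> \<open>Precomposing with this translation makes the transpose vanish at
    \<open>0\<close>, so that \<open>f'\<close> comes from \<Delta>.\<close>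
  define f' where "f' = (\<lambda>x. f (x + k))"
  have f': "f' \<in> cyclic_maps n m"
    using cyclic_maps_comp[OF translation_cyclic_maps assms(1), of k] by (simp add: f'_def comp_def)
  have transp: "transp f' y = transp f y - k" for y
    unfolding f'_def by (rule transp_add(2)[OF assms(1)])
  have "f = f' \<circ> (\<lambda>x. x + - k)"
    by (simp add: f'_def fun_eq_iff)
  then have "act n m f \<beta> = act n m f' (rot n k \<beta>)"
    using act_comp[OF translation_cyclic_maps f' assms(2), of "- k"] by (simp add: rot_def)
  moreover have "unroll b t m (act n m f' (rot n k \<beta>)) = unroll b t n (rot n k \<beta>) \<circ> transp f'"
    by (rule unroll_act_Delta[OF f' _ rot_seqs[OF assms(2)]]) (simp add: transp k_def)
  ultimately show ?thesis by (simp add: transp k_def)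
qed

text \<open>This will be \<open>x\<inverse> y\<close> for the values \<open>x\<close> at \<open>k\<close> and \<open>y\<close> at \<open>l\<close> of the periodic extension of \<open>\<beta>\<close>.\<close>

definition quot :: "nat \<Rightarrow> (nat \<Rightarrow> 'a) \<Rightarrow> int \<Rightarrow> int \<Rightarrow> (int \<times> 'a) set" where
  "quot n \<beta> k l = unroll b t n (rot n k \<beta>) (l - k)"

text \<open>Following \<open>f\<close> by a rotation is again a single arrow, so
  \<open>unroll_act\<close> applies to it. Both sides then come from rotating \<beta> to the place
  \<open>f\<^sup>t(k)\<close>.\<close>

lemma quot_act:
  assumes "f \<in> cyclic_maps n m" "\<beta> \<in> seqs b t n"
  shows "quot m (act n m f \<beta>) k l = quot n \<beta> (transp f k) (transp f l)"
proof -
  define g where "g = (\<lambda>x. x + - k) \<circ> f"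
  have g: "g \<in> cyclic_maps n m"
    unfolding g_def by (rule cyclic_maps_comp[OF assms(1) translation_cyclic_maps])
  have "transp g y = transp f (y + k)" for y
    using transp_add(1)[OF assms(1), of "- k" y] by (simp add: g_def comp_def)
  moreover have "rot m k (act n m f \<beta>) = act n m g \<beta>"
    unfolding rot_def g_def by (rule act_comp[OF assms(1) translation_cyclic_maps assms(2), symmetric])
  ultimately show ?thesis
    using unroll_act[OF g assms(2)] by (simp add: quot_def)
qed

text \<open>The map \<open>q\<close> is the transpose of the arrow that restricts \<beta> to
  \<open>\<beta>'\<close>.\<close>

lemma quot_refine:
  assumes "\<beta> \<in> seqs b t n" "\<beta>' \<in> seqs b t m" "\<beta>' ` {..m+1} \<subseteq> \<beta> ` {..n+1}"
  obtains q where "unroll b t m \<beta>' = unroll b t n \<beta> \<circ> q"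
    "\<And>k l. quot m \<beta>' k l = quot n \<beta> (q k) (q l)"
proof -
  obtain f where f: "f \<in> Mor Delta n m" "\<beta>' = (\<lambda>j\<in>{..m+1}. \<beta> (upper_star n f j))"
    using seqs_refine[OF assms] .
  define g where "g = periodic_ext n m f"
  have g: "g \<in> cyclic_maps n m" "transp g 0 = 0"
    using periodic_ext_cyclic[OF f(1)] transp_periodic_ext[OF f(1), of 0] upper_star_ends(1)[OF f(1)]
    by (simp_all add: g_def)
  have \<beta>': "\<beta>' = act n m g \<beta>"
    unfolding g_def f(2) by (rule act_incl_j[OF f(1) assms(1), symmetric])
  show ?thesis
    using that[of "transp g"] unroll_act_Delta[OF g assms(1)] quot_act[OF g(1) assms(1)]
    unfolding \<beta>' by blast
qed

lemma quot_cong: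
  assumes "\<beta> \<in> seqs b t n" "\<beta>' \<in> seqs b t m"
    and "unroll b t n \<beta> k = unroll b t m \<beta>' k'" "unroll b t n \<beta> l = unroll b t m \<beta>' l'"
  shows "quot n \<beta> k l = quot m \<beta>' k' l'"
proof -
  obtain N \<alpha> where \<alpha>: "\<alpha> \<in> seqs b t N" "strict_mono_on {..N+1} \<alpha>"
    "\<beta> ` {..n+1} \<union> \<beta>' ` {..m+1} \<subseteq> \<alpha> ` {..N+1}"
    using strict_seq_through[of "\<beta> ` {..n+1} \<union> \<beta>' ` {..m+1}"] by (metis finite_Un finite_atMost finite_imageI)
  obtain q where q: "unroll b t n \<beta> = unroll b t N \<alpha> \<circ> q"
    "\<And>k l. quot n \<beta> k l = quot N \<alpha> (q k) (q l)"
    using quot_refine[OF \<alpha>(1) assms(1)] \<alpha>(3) by (metis le_supE)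
  obtain q' where q': "unroll b t m \<beta>' = unroll b t N \<alpha> \<circ> q'"
    "\<And>k l. quot m \<beta>' k l = quot N \<alpha> (q' k) (q' l)"
    using quot_refine[OF \<alpha>(1) assms(2)] \<alpha>(3) by (metis le_supE)
  \<comment> \<open>The periodic extension of the strictly increasing refinement is injective, so
    equal values sit at the same place.\<close>
  have "q k = q' k'" "q l = q' l'"
    using assms(3,4) unroll_inj[OF \<alpha>(1,2)] by (auto simp: q(1) q'(1) inj_def)
  then show ?thesis by (simp add: q(2) q'(2))
qed

section \<open>Left division on the glued order\<close>

text \<open>On elements of \<open>Gset b t\<close>, candidates exist by
  \<open>line_through3\<close>, and they all agree by \<open>quot_cong\<close>.\<close>

definition ldiv :: "(int \<times> 'a) set \<Rightarrow> (int \<times> 'a) set \<Rightarrow> (int \<times> 'a) set" where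
  "ldiv x y = (SOME z. \<exists>n \<beta> k l. \<beta> \<in> seqs b t n \<and> x = unroll b t n \<beta> k \<and> y = unroll b t n \<beta> l \<and>
     z = quot n \<beta> k l)"

lemma ldiv_unroll:
  assumes "\<beta> \<in> seqs b t n"
  shows "ldiv (unroll b t n \<beta> k) (unroll b t n \<beta> l) = quot n \<beta> k l"
  unfolding ldiv_def by (rule some_equality) (use assms quot_cong in blast)+

lemma ldiv_closed:
  assumes "x \<in> Gset b t" "y \<in> Gset b t"
  shows "ldiv x y \<in> Gset b t"
proof -
  obtain n \<beta> k l m where \<beta>: "\<beta> \<in> seqs b t n" "x = unroll b t n \<beta> k" "y = unroll b t n \<beta> l"
    using line_through3[OF assms assms(2)] by metis
  show ?thesis
    unfolding \<beta>(2,3) ldiv_unroll[OF \<beta>(1)] quot_def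
    by (rule linesD(1)[OF unroll_lines[OF rot_seqs[OF \<beta>(1)]]])
qed

lemma ldiv_one:
  assumes "x \<in> Gset b t"
  shows "ldiv (cc b t 0) x = x"
proof -
  obtain n \<beta> k l m where \<beta>: "\<beta> \<in> seqs b t n" "x = unroll b t n \<beta> k"
    using line_through3[OF assms assms assms] by metis
  show ?thesis
    using ldiv_unroll[OF \<beta>(1), of 0 k] by (simp add: unroll_0 \<beta> quot_def rot_0)
qed

lemma ldiv_self:
  assumes "x \<in> Gset b t"
  shows "ldiv x x = cc b t 0"
proof -
  obtain n \<beta> k l m where \<beta>: "\<beta> \<in> seqs b t n" "x = unroll b t n \<beta> k"
    using line_through3[OF assms assms assms] by metis
  show ?thesis
    unfolding \<beta>(2) ldiv_unroll[OF \<beta>(1)] using unroll_0[OF rot_seqs[OF \<beta>(1)]] by (simp add: quot_def)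
qed

text \<open>Both inner quotients are values, at \<open>l - k\<close> and \<open>m - k\<close>, of
  the one sequence \<open>rot n k \<beta>\<close>. Rotating it further by \<open>l - k\<close>
  amounts to rotating \<beta> by \<open>l\<close>.\<close>

lemma ldiv_cancel:
  assumes "x \<in> Gset b t" "y \<in> Gset b t" "z \<in> Gset b t"
  shows "ldiv (ldiv x y) (ldiv x z) = ldiv y z"
proof -
  obtain n \<beta> k l m where \<beta>: "\<beta> \<in> seqs b t n"
    "x = unroll b t n \<beta> k" "y = unroll b t n \<beta> l" "z = unroll b t n \<beta> m"
    using line_through3[OF assms] .
  show ?thesis
    unfolding \<beta>(2-4) ldiv_unroll[OF \<beta>(1)]
    unfolding quot_def ldiv_unroll[OF rot_seqs[OF \<beta>(1)]]
    by (simp add: quot_def rot_rot[OF \<beta>(1)])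
qed

text \<open>A shift moves a place by full periods. In the second argument this shifts the value read
  off; in both, the rotation and the difference of places stay the same.\<close>

lemma ldiv_shift:
  assumes "x \<in> Gset b t" "y \<in> Gset b t"
  shows "ldiv x (shift p y) = shift p (ldiv x y)" "ldiv (shift p x) (shift p y) = ldiv x y"
proof -
  obtain n \<beta> k l m where \<beta>: "\<beta> \<in> seqs b t n" "x = unroll b t n \<beta> k" "y = unroll b t n \<beta> l"
    using line_through3[OF assms assms(2)] by metis
  have shift: "shift p (unroll b t n \<beta> i) = unroll b t n \<beta> (i + p * (int n + 1))" for i
    by (rule linesD(3)[OF unroll_lines[OF \<beta>(1)], symmetric])
  show "ldiv x (shift p y) = shift p (ldiv x y)"
    unfolding \<beta>(2,3) shift ldiv_unroll[OF \<beta>(1)] quot_def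
    using linesD(3)[OF unroll_lines[OF rot_seqs[OF \<beta>(1)]], of k "l - k" p]
    by (simp add: algebra_simps)
  show "ldiv (shift p x) (shift p y) = ldiv x y"
    unfolding \<beta>(2,3) shift ldiv_unroll[OF \<beta>(1)] quot_def rot_period by simp
qed

lemma ldiv_mono:
  assumes "x \<in> Gset b t" "y \<in> Gset b t" "z \<in> Gset b t" "G_le y z"
  shows "G_le (ldiv x y) (ldiv x z)"
proof -
  obtain n \<beta> k l m where \<beta>: "\<beta> \<in> seqs b t n"
    "x = unroll b t n \<beta> k" "y = unroll b t n \<beta> l" "z = unroll b t n \<beta> m"
    using line_through3[OF assms(1-3)] .
  note order = G_le_total_order[OF interval]
  show ?thesis
  proof (cases "l \<le> m")
    case True
    then show ?thesis
      unfolding \<beta>(2-4) ldiv_unroll[OF \<beta>(1)] quot_def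
      by (intro linesD(2)[OF unroll_lines[OF rot_seqs[OF \<beta>(1)]]]) simp
  next
    \<comment> \<open>Equal values may occupy several places, so the places can be in the wrong
      order; the values then coincide.\<close>
    case False
    then have "G_le z y"
      unfolding \<beta>(3,4) by (intro linesD(2)[OF unroll_lines[OF \<beta>(1)]]) simp
    then have "y = z" using order(2) assms by blast
    then show ?thesis using order(1)[OF ldiv_closed ldiv_closed] assms by blast
  qed
qed

section \<open>The group law of a cyclic structure\<close>

definition group_law :: "(int \<times> 'a) set monoid" where
  "group_law = \<lparr>carrier = Gset b t,
     mult = (\<lambda>x y. if x \<in> Gset b t \<and> y \<in> Gset b t then ldiv (ldiv x (cc b t 0)) y else undefined),
     one = cc b t 0\<rparr>"

lemma group_law:
  "group group_law"
  "x \<in> Gset b t \<Longrightarrow> y \<in> Gset b t \<Longrightarrow> inv\<^bsub>group_law\<^esub> x \<otimes>\<^bsub>group_law\<^esub> y = ldiv x y"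
  unfolding group_law_def
  by (rule group_of_division; simp add: cc_in_Gset ldiv_closed ldiv_one ldiv_self ldiv_cancel)+

lemma group_law_in_group_laws: "group_law \<in> group_laws b t"
proof -
  note closed = ldiv_closed[OF _ cc_in_Gset]
  have cc: "cc b t k = shift k (cc b t 0)" for k by (simp add: cc_def)
  have mult: "x \<otimes>\<^bsub>group_law\<^esub> y = ldiv (ldiv x (cc b t 0)) y" if "x \<in> Gset b t" "y \<in> Gset b t" for x y
    using that by (simp add: group_law_def)
  have left: "cc b t k \<otimes>\<^bsub>group_law\<^esub> x = shift k x" if x: "x \<in> Gset b t" for k x
  proof -
    \<comment> \<open>The inverse of \<open>c(k)\<close> is \<open>c(-k)\<close>. The product is
      therefore a quotient whose two arguments are both shifts by \<open>- k\<close>, and these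
      shifts cancel.\<close>
    have "ldiv (cc b t k) (cc b t 0) = cc b t (- k)"
      using ldiv_shift(2)[OF cc_in_Gset cc_in_Gset, of k 0 "- k"] ldiv_one[OF cc_in_Gset, of "- k"]
      by (simp add: cc_def)
    moreover have "cc b t (- k) = shift (- k) (cc b t 0)" "x = shift (- k) (shift k x)"
      using x by (simp_all add: cc_def shift_shift shift_0)
    ultimately show ?thesis
      using x by (metis mult cc_in_Gset ldiv_shift(2) shift_Gset ldiv_one)
  qed
  have right: "x \<otimes>\<^bsub>group_law\<^esub> cc b t k = shift k x" if x: "x \<in> Gset b t" for k x
  proof -
    have "ldiv (ldiv x (cc b t 0)) (cc b t k) = shift k (ldiv (ldiv x (cc b t 0)) (cc b t 0))"
      unfolding cc[of k] by (rule ldiv_shift(1)[OF closed[OF x] cc_in_Gset])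
    also have "ldiv (ldiv x (cc b t 0)) (cc b t 0) = x"
      using ldiv_cancel[OF x cc_in_Gset x, of 0] ldiv_self[OF x] ldiv_one[OF x] by simp
    finally show ?thesis using mult[OF x cc_in_Gset] by simp
  qed
  have "G_le (g \<otimes>\<^bsub>group_law\<^esub> x) (g \<otimes>\<^bsub>group_law\<^esub> y)"
    if "g \<in> Gset b t" "x \<in> Gset b t" "y \<in> Gset b t" "G_le x y" for g x y
    using that ldiv_mono[OF closed] by (simp add: mult)
  moreover have "carrier group_law = Gset b t"
    "\<not> (x \<in> Gset b t \<and> y \<in> Gset b t) \<longrightarrow> x \<otimes>\<^bsub>group_law\<^esub> y = undefined" for x y
    by (auto simp: group_law_def)
  ultimately show ?thesis
    unfolding group_laws_def
    using group_law(1) left[OF cls_in_Gset] right[OF cls_in_Gset] by (simp add: add.commute)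
qed

text \<open>After unrolling, the value at \<open>x\<close> on the side of the group is the quotient
  for the places \<open>f\<^sup>t(0)\<close> and \<open>f\<^sup>t(x)\<close>, which is what
  \<open>unroll_act\<close> gives for the original functor.\<close>

lemma cyclic_of_group_law: "cyclic_of_group b t group_law = F"
proof -
  define F' where "F' = cyclic_of_group b t group_law"
  note M = group_law_in_group_laws
  have "Ar F' n m \<phi> = Ar F n m \<phi>" for n m \<phi>
  proof (cases "\<phi> \<in> Mor Lambda n m")
    case True
    obtain f where f: "f \<in> cyclic_maps n m" "\<phi> = Lambda_class n m f" using Lambda_Mor_cases[OF True] .
    show ?thesis
    proof (rule extensionalityI)
      show "Ar F' n m \<phi> \<in> extensional (seqs b t n)"
        using True by (simp add: F'_def cyclic_of_group_def)
      show "Ar F n m \<phi> \<in> extensional (seqs b t n)"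
        using Ar_funcset[OF True] by (simp add: PiE_def)
      fix \<beta> assume \<beta>: "\<beta> \<in> seqs b t n"
      show "Ar F' n m \<phi> \<beta> = Ar F n m \<phi> \<beta>"
      proof (rule unroll_inject)
        show "Ar F' n m \<phi> \<beta> \<in> seqs b t m"
          unfolding F'_def f(2) by (rule unroll_Ar_cyclic_of_group(1)[OF M f(1) \<beta>])
        show "Ar F n m \<phi> \<beta> \<in> seqs b t m"
          unfolding f(2) by (rule act_seqs[OF f(1) \<beta>])
        show "unroll b t m (Ar F' n m \<phi> \<beta>) = unroll b t m (Ar F n m \<phi> \<beta>)"
          unfolding F'_def f(2) unroll_Ar_cyclic_of_group(2)[OF M f(1) \<beta>]
          using linesD(1)[OF unroll_lines[OF \<beta>]]
          by (simp add: fun_eq_iff based_def group_law(2) ldiv_unroll[OF \<beta>] quot_def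
              unroll_act[OF f(1) \<beta>])
      qed
    qed
  next
    case False
    then show ?thesis
      using functorial by (simp add: F'_def cyclic_of_group_def is_functor_def)
  qed
  then have "Ar F' = Ar F" by (simp add: fun_eq_iff)
  moreover have "Ob F' = Ob F" by (simp add: F'_def Ob_eq)
  ultimately show ?thesis by (simp add: F'_def[symmetric])
qed

end

theorem theorem5p1:
  fixes b t :: "'i::linorder"
  assumes "is_interval b t"
  shows "bij_betw (cyclic_of_group b t) (group_laws b t) (cyclic_structures b t)"
proof -
  interpret interval b t by (unfold_locales) (rule assms)
  have "F \<in> cyclic_of_group b t ` group_laws b t" if "F \<in> cyclic_structures b t" for F
  proof -
    interpret cyclic_structure b t F by unfold_locales (rule that)
    show ?thesis using cyclic_of_group_law group_law_in_group_laws by (metis imageI)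
  qed
  then show ?thesis
    using inj_on_cyclic_of_group cyclic_of_group_in_cyclic_structures by (auto simp: bij_betw_def)
qed

end
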